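(* Let $(M,\nabla,\circ,e)$ be a homogeneous flat F-manifold of dimension $N$ with Euler vector field $E$, considered around a semisimple point, with canonical coordinates $u^1,\ldots,u^N$ chosen so that $E=\sum_iu^i\frac{\partial}{\partial u^i}$. Let $U=\mathrm{diag}(u^1,\ldots,u^N)$, let $\Gamma=(\gamma^i_j)$ be the matrix of rotation coefficients and $\delta_1,\ldots,\delta_N\in\mathbb C$ the constants defined in the context. Then there exists a unique sequence of matrices $R_0=\mathrm{Id},R_1,R_2,\ldots$ (of functions around the given point) satisfying the differential equations $$dR_{k-1}+R_{k-1}[\Gamma,dU]=[R_k,dU],\quad k\ge1,$$ and the homogeneity condition $$\sum_su^s\frac{\partial(R_k)^i_j}{\partial u^s}=(\delta_i-\delta_j-k)(R_k)^i_j,\quad k\ge0,\ 1\le i,j\le N.$$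
   Context: A flat F-manifold $(M,\nabla,\circ,e)$ is an analytic manifold $M$ with an analytic connection $\nabla$ on $TM$, an algebra structure $(T_pM,\circ)$ with unit $e$ on each tangent space, analytic in $p$, such that $\nabla+z\circ$ is flat and torsionless for every $z\in\mathbb C$ and $\nabla e=0$. A point is semisimple if $T_pM$ has a basis of idempotents $\pi_k\circ\pi_l=\delta_{k,l}\pi_k$; around it there are canonical coordinates $u^i$ with $\frac{\partial}{\partial u^k}\circ\frac{\partial}{\partial u^l}=\delta_{k,l}\frac{\partial}{\partial u^k}$. Let $t^1,\ldots,t^N$ be flat coordinates of $\nabla$. The flat F-manifold is homogeneous if there is a vector field (Euler vector field) of the form $E=\sum_\alpha((1-q_\alpha)t^\alpha+r^\alpha)\frac{\partial}{\partial t^\alpha}$, $q_\alpha,r^\alpha\in\mathbb C$, with $[e,E]=e$ and $\mathrm{Lie}_E(\circ)=\circ$. After shifting canonical coordinates by constants one has $E=\sum_iu^i\frac{\partial}{\partial u^i}$. Let $\widetilde\Psi=(\frac{\partial u^i}{\partial t^\alpha})$ (row $i$, column $\alpha$). Then $d\widetilde\Psi\cdot\widetilde\Psi^{-1}=\widetilde D+[\widetilde\Gamma,dU]$ with $\widetilde D$ a diagonal matrix of closed one-forms and $\widetilde\Gamma$ a matrix of functions with zero diagonal. Let $H=\mathrm{diag}(H_1,\ldots,H_N)$ be a nondegenerate diagonal matrix with $dH\cdot H^{-1}=-\widetilde D$ (unique up to $H_i\mapsto\lambda_iH_i$, $\lambda_i\in\mathbb C^*$), and $\Gamma=(\gamma^i_j):=H\widetilde\Gamma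 H^{-1}$. It is known that there are constants $\delta_i\in\mathbb C$ with $i_E\widetilde D=-\mathrm{diag}(\delta_1,\ldots,\delta_N)$, equivalently $\sum_ju^j\frac{\partial H_i}{\partial u^j}=\delta_iH_i$. Everything is considered on a small (connected, simply connected) neighbourhood of the point. *)

theory Defs
  imports "HOL-Analysis.Analysis"
begin

text \<open>
  The manifold is given in a coordinate chart, as an open subset \<open>M\<close> of \<open>complex^'n\<close>.  The tangent
  space at every point is identified with \<open>complex^'n\<close>, and the chart is arbitrary: it need not be
  flat or canonical.  \<open>frechet_derivative f (at p)\<close> is the differential of \<open>f\<close> at \<open>p\<close>.
\<close>

text \<open>
  Analytic means complex-analytic.  As for the one-variable constants \<open>holomorphic_on\<close> and
  \<open>analytic_on\<close>, this is expressed by complex differentiability on an open set.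
\<close>

definition holomorphic_fun_on :: "(complex^'n \<Rightarrow> complex) \<Rightarrow> (complex^'n) set \<Rightarrow> bool" where
  "holomorphic_fun_on f S \<longleftrightarrow> open S \<and>
     (\<forall>p\<in>S. \<exists>f'. (f has_derivative f') (at p) \<and> Vector_Spaces.linear (*s) (*) f')"

definition holomorphic_vec_on :: "(complex^'n \<Rightarrow> complex^'m) \<Rightarrow> (complex^'n) set \<Rightarrow> bool" where
  "holomorphic_vec_on X S \<longleftrightarrow> (\<forall>i. holomorphic_fun_on (\<lambda>p. X p $ i) S)"

definition holomorphic_mat_on :: "(complex^'n \<Rightarrow> complex^'m^'k) \<Rightarrow> (complex^'n) set \<Rightarrow> bool" where
  "holomorphic_mat_on A S \<longleftrightarrow> (\<forall>i j. holomorphic_fun_on (\<lambda>p. A p $ i $ j) S)"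


subsection \<open>Connections and flat F-manifolds\<close>

type_synonym 'n vfield = "complex^'n \<Rightarrow> complex^'n"

text \<open>
  A bilinear map on each tangent space.  This is used for the product \<open>\<circ>\<close> and for the Christoffel
  symbols of a connection in the chart.
\<close>

type_synonym 'n tensor21 = "complex^'n \<Rightarrow> complex^'n \<Rightarrow> complex^'n \<Rightarrow> complex^'n"

definition holomorphic_tensor21_on :: "'n::finite tensor21 \<Rightarrow> (complex^'n) set \<Rightarrow> bool" where
  "holomorphic_tensor21_on B S \<longleftrightarrow>
     (\<forall>p\<in>S. \<forall>v. Vector_Spaces.linear (*s) (*s) (B p v)) \<and>
     (\<forall>p\<in>S. \<forall>w. Vector_Spaces.linear (*s) (*s) (\<lambda>v. B p v w)) \<and>
     (\<forall>v w. holomorphic_vec_on (\<lambda>p. B p v w) S)"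

definition lie_bracket :: "'n::finite vfield \<Rightarrow> 'n vfield \<Rightarrow> 'n vfield" where
  "lie_bracket X Y p = frechet_derivative Y (at p) (X p) - frechet_derivative X (at p) (Y p)"

definition nabla :: "'n::finite tensor21 \<Rightarrow> 'n vfield \<Rightarrow> 'n vfield \<Rightarrow> 'n vfield" where
  "nabla Chr X Y p = frechet_derivative Y (at p) (X p) + Chr p (X p) (Y p)"

definition torsionless_on :: "'n::finite tensor21 \<Rightarrow> (complex^'n) set \<Rightarrow> bool" where
  "torsionless_on Chr M \<longleftrightarrow>
     (\<forall>X Y. holomorphic_vec_on X M \<longrightarrow> holomorphic_vec_on Y M \<longrightarrow>
        (\<forall>p\<in>M. nabla Chr X Y p - nabla Chr Y X p = lie_bracket X Y p))"

definition flat_on :: "'n::finite tensor21 \<Rightarrow> (complex^'n) set \<Rightarrow> bool" where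
  "flat_on Chr M \<longleftrightarrow>
     (\<forall>X Y Z. holomorphic_vec_on X M \<longrightarrow> holomorphic_vec_on Y M \<longrightarrow> holomorphic_vec_on Z M \<longrightarrow>
        (\<forall>p\<in>M. nabla Chr X (nabla Chr Y Z) p - nabla Chr Y (nabla Chr X Z) p
                  - nabla Chr (lie_bracket X Y) Z p = 0))"

definition vf_mult :: "'n::finite tensor21 \<Rightarrow> 'n vfield \<Rightarrow> 'n vfield \<Rightarrow> 'n vfield" where
  "vf_mult mlt X Y p = mlt p (X p) (Y p)"

text \<open>Associativity and commutativity of the product follow from the flatness and torsion conditions.\<close>

definition flat_F_manifold ::
  "(complex^'n::finite) set \<Rightarrow> 'n tensor21 \<Rightarrow> 'n tensor21 \<Rightarrow> 'n vfield \<Rightarrow> bool" where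
  "flat_F_manifold M Chr mlt e \<longleftrightarrow>
     open M \<and>
     holomorphic_tensor21_on Chr M \<and>
     holomorphic_tensor21_on mlt M \<and>
     holomorphic_vec_on e M \<and>
     (\<forall>p\<in>M. \<forall>v. mlt p (e p) v = v \<and> mlt p v (e p) = v) \<and>
     (\<forall>z::complex. flat_on (\<lambda>p v w. Chr p v w + z *s mlt p v w) M \<and>
                   torsionless_on (\<lambda>p v w. Chr p v w + z *s mlt p v w) M) \<and>
     (\<forall>X. holomorphic_vec_on X M \<longrightarrow> (\<forall>p\<in>M. nabla Chr X e p = 0))"

definition semisimple_point :: "'n::finite tensor21 \<Rightarrow> complex^'n \<Rightarrow> bool" where
  "semisimple_point mlt p \<longleftrightarrow>
     (\<exists>b :: 'n \<Rightarrow> complex^'n.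
        inj b \<and> vec.independent (range b) \<and> vec.span (range b) = UNIV \<and>
        (\<forall>k l. mlt p (b k) (b l) = (if k = l then b k else 0)))"


subsection \<open>Coordinates\<close>

definition coordinates_on :: "(complex^'n \<Rightarrow> complex^'n::finite) \<Rightarrow> (complex^'n) set \<Rightarrow> bool" where
  "coordinates_on x V \<longleftrightarrow>
     holomorphic_vec_on x V \<and> inj_on x V \<and> (\<forall>p\<in>V. bij (frechet_derivative x (at p)))"

text \<open>The vector field \<open>\<partial>/\<partial>x\<^sup>k\<close>: the differential of \<open>x\<close> sends it to the \<open>k\<close>-th standard basis vector.\<close>

definition coord_vf :: "(complex^'n \<Rightarrow> complex^'n::finite) \<Rightarrow> 'n \<Rightarrow> 'n vfield" where
  "coord_vf x k p = inv (frechet_derivative x (at p)) (axis k 1)"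

definition coord_partial ::
  "(complex^'n \<Rightarrow> complex^'n::finite) \<Rightarrow> 'n \<Rightarrow> (complex^'n \<Rightarrow> complex) \<Rightarrow> complex^'n \<Rightarrow> complex" where
  "coord_partial x k f p = frechet_derivative f (at p) (coord_vf x k p)"

definition flat_coordinates ::
  "'n::finite tensor21 \<Rightarrow> (complex^'n) set \<Rightarrow> (complex^'n \<Rightarrow> complex^'n) \<Rightarrow> bool" where
  "flat_coordinates Chr V t \<longleftrightarrow>
     coordinates_on t V \<and> (\<forall>X \<alpha>. \<forall>p\<in>V. nabla Chr X (coord_vf t \<alpha>) p = 0)"

definition canonical_coordinates ::
  "'n::finite tensor21 \<Rightarrow> (complex^'n) set \<Rightarrow> (complex^'n \<Rightarrow> complex^'n) \<Rightarrow> bool" where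
  "canonical_coordinates mlt V u \<longleftrightarrow>
     coordinates_on u V \<and>
     (\<forall>k l. \<forall>p\<in>V. mlt p (coord_vf u k p) (coord_vf u l p) = (if k = l then coord_vf u k p else 0))"

text \<open>
  The condition \<open>Lie\<^sub>E(\<circ>) = \<circ>\<close> is evaluated on vector fields \<open>X\<close>, \<open>Y\<close>.  The last clause says that \<open>E\<close>
  has the form \<open>\<Sum>\<^sub>\<alpha> ((1 - q\<^sub>\<alpha>) t\<^sup>\<alpha> + r\<^sup>\<alpha>) \<partial>/\<partial>t\<^sup>\<alpha>\<close> on the domain \<open>V\<close> of the flat coordinates \<open>t\<close>.
\<close>

definition euler_vector_field ::
  "(complex^'n::finite) set \<Rightarrow> 'n tensor21 \<Rightarrow> 'n vfield \<Rightarrow>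
   (complex^'n) set \<Rightarrow> (complex^'n \<Rightarrow> complex^'n) \<Rightarrow> 'n vfield \<Rightarrow> bool" where
  "euler_vector_field M mlt e V t E \<longleftrightarrow>
     holomorphic_vec_on E M \<and>
     (\<forall>p\<in>M. lie_bracket e E p = e p) \<and>
     (\<forall>X Y. holomorphic_vec_on X M \<longrightarrow> holomorphic_vec_on Y M \<longrightarrow>
        (\<forall>p\<in>M. lie_bracket E (vf_mult mlt X Y) p - vf_mult mlt (lie_bracket E X) Y p
                  - vf_mult mlt X (lie_bracket E Y) p = vf_mult mlt X Y p)) \<and>
     (\<exists>q r :: complex^'n. \<forall>p\<in>V.
        E p = (\<Sum>\<alpha>\<in>UNIV. ((1 - q $ \<alpha>) * t p $ \<alpha> + r $ \<alpha>) *s coord_vf t \<alpha> p))"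


subsection \<open>Matrices of functions and of one-forms\<close>

text \<open>
  A matrix of one-forms is a function of a point \<open>p\<close> and a tangent vector \<open>v\<close>.  In particular the
  differential of a matrix of functions \<open>A\<close> is \<open>\<lambda>p v. mat_d A p v\<close>.
\<close>

definition mat_d :: "(complex^'n \<Rightarrow> complex^'m^'k) \<Rightarrow> complex^'n \<Rightarrow> complex^'n \<Rightarrow> complex^'m^'k" where
  "mat_d A p v = frechet_derivative A (at p) v"

definition diag_mat :: "complex^'n \<Rightarrow> complex^'n^'n" where
  "diag_mat a = (\<chi> i j. if i = j then a $ i else 0)"

definition commutator :: "complex^'n^'n \<Rightarrow> complex^'n^'n \<Rightarrow> complex^'n^'n::finite" where
  "commutator A B = A ** B - B ** A"

definition closed_one_form_on ::
  "(complex^'n \<Rightarrow> complex^'n \<Rightarrow> complex) \<Rightarrow> (complex^'n) set \<Rightarrow> bool" where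
  "closed_one_form_on \<omega> V \<longleftrightarrow>
     (\<forall>p\<in>V. Vector_Spaces.linear (*s) (*) (\<omega> p)) \<and>
     (\<forall>v. holomorphic_fun_on (\<lambda>p. \<omega> p v) V) \<and>
     (\<forall>p\<in>V. \<forall>v w. frechet_derivative (\<lambda>x. \<omega> x w) (at p) v
                   = frechet_derivative (\<lambda>x. \<omega> x v) (at p) w)"

definition Psi_tilde ::
  "(complex^'n \<Rightarrow> complex^'n) \<Rightarrow> (complex^'n \<Rightarrow> complex^'n::finite) \<Rightarrow> complex^'n \<Rightarrow> complex^'n^'n" where
  "Psi_tilde t u p = (\<chi> i \<alpha>. coord_partial t \<alpha> (\<lambda>x. u x $ i) p)"

text \<open>
  \<open>Dt\<close> and \<open>Gt\<close> are the matrices in \<open>d\<Psi> \<Psi>\<^sup>-\<^sup>1 = D + [\<Gamma>, dU]\<close>, for \<open>\<Psi> = Psi_tilde t u\<close>.  They are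
  uniquely determined by \<open>t\<close> and \<open>u\<close>.
\<close>

definition Psi_tilde_decomposition ::
  "(complex^'n::finite) set \<Rightarrow> (complex^'n \<Rightarrow> complex^'n) \<Rightarrow> (complex^'n \<Rightarrow> complex^'n) \<Rightarrow>
   (complex^'n \<Rightarrow> complex^'n \<Rightarrow> complex^'n^'n) \<Rightarrow> (complex^'n \<Rightarrow> complex^'n^'n) \<Rightarrow> bool" where
  "Psi_tilde_decomposition V t u Dt Gt \<longleftrightarrow>
     (\<forall>i. closed_one_form_on (\<lambda>p v. Dt p v $ i $ i) V) \<and>
     (\<forall>p\<in>V. \<forall>v i j. i \<noteq> j \<longrightarrow> Dt p v $ i $ j = 0) \<and>
     holomorphic_mat_on Gt V \<and>
     (\<forall>p\<in>V. \<forall>i. Gt p $ i $ i = 0) \<and>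
     (\<forall>p\<in>V. \<forall>v. mat_d (Psi_tilde t u) p v ** matrix_inv (Psi_tilde t u p)
                = Dt p v + commutator (Gt p) (mat_d (\<lambda>x. diag_mat (u x)) p v))"

definition homogeneous_R_matrices ::
  "(complex^'n::finite) set \<Rightarrow> (complex^'n \<Rightarrow> complex^'n) \<Rightarrow> (complex^'n \<Rightarrow> complex^'n^'n) \<Rightarrow>
   complex^'n \<Rightarrow> (nat \<Rightarrow> complex^'n \<Rightarrow> complex^'n^'n) \<Rightarrow> bool" where
  "homogeneous_R_matrices W u G \<delta> R \<longleftrightarrow>
     (\<forall>k. holomorphic_mat_on (R k) W) \<and>
     (\<forall>p\<in>W. R 0 p = mat 1) \<and>
     (\<forall>k\<ge>1. \<forall>p\<in>W. \<forall>v.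
        mat_d (R (k - 1)) p v + R (k - 1) p ** commutator (G p) (mat_d (\<lambda>x. diag_mat (u x)) p v)
          = commutator (R k p) (mat_d (\<lambda>x. diag_mat (u x)) p v)) \<and>
     (\<forall>k i j. \<forall>p\<in>W.
        (\<Sum>s\<in>UNIV. u p $ s * coord_partial u s (\<lambda>x. R k x $ i $ j) p)
          = (\<delta> $ i - \<delta> $ j - of_nat k) * R k p $ i $ j)"

end

theory Submission
  imports Defs "HOL-Complex_Analysis.Cauchy_Integral_Formula"
begin

text \<open>
  Contract the equations with the coordinate fields \<open>\<partial>\<^sub>a = \<partial>/\<partial>u\<^sup>a\<close> and write \<open>A = [\<Gamma>, dU]\<close>,
  \<open>\<omega>\<^sub>k = dR\<^sub>k + R\<^sub>k A\<close>.  The entry \<open>(i,j)\<close> of \<open>[R\<^sub>k\<^sub>+\<^sub>1, dU]\<close> is \<open>(R\<^sub>k\<^sub>+\<^sub>1)\<^sub>i\<^sub>j (du\<^sup>j - du\<^sup>i)\<close>, so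
  \<open>\<omega>\<^sub>k(\<partial>\<^sub>j)\<close> determines the off-diagonal part of \<open>R\<^sub>k\<^sub>+\<^sub>1\<close>.  The diagonal of \<open>\<omega>\<^sub>k\<^sub>+\<^sub>1\<close> has to vanish;
  contracting it with \<open>E\<close> and using homogeneity gives
  \<open>(k+1) (R\<^sub>k\<^sub>+\<^sub>1)\<^sub>i\<^sub>i = \<Sum>\<^sub>l (R\<^sub>k\<^sub>+\<^sub>1)\<^sub>i\<^sub>l \<gamma>\<^sub>l\<^sub>i (u\<^sup>i - u\<^sup>l)\<close>.  Hence \<open>R\<^sub>k\<^sub>+\<^sub>1\<close> is an explicit differential expression
  in \<open>R\<^sub>k\<close> (\<open>next_coeff\<close>, \<open>R_matrices_recursion\<close>), which is uniqueness, on any open set.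

  For existence one checks that the matrices defined by this recursion solve the equations.
  The input is that \<open>\<Psi> = H \<Psi>~\<close> satisfies \<open>d\<Psi> = A \<Psi>\<close> and
  \<open>E \<Psi> = diag(\<delta>) \<Psi> + \<Psi> Q\<close> with a constant matrix \<open>Q\<close>.  The first property gives the flatness
  \<open>dA = A \<and> A\<close> (\<open>flat_connection\<close>), the second one that \<open>\<gamma>\<^sup>i\<^sub>j\<close> has degree \<open>\<delta>\<^sub>i - \<delta>\<^sub>j - 1\<close>
  (\<open>homogeneous_connection\<close>).  By flatness, the exterior derivative of \<open>\<omega>\<^sub>k = [R\<^sub>k\<^sub>+\<^sub>1, dU]\<close> says that
  \<open>(\<omega>\<^sub>k\<^sub>+\<^sub>1)\<^sub>i\<^sub>j \<and> (du\<^sup>j - du\<^sup>i) = 0\<close> (\<open>cov_curl\<close>), so the off-diagonal entries of \<open>\<omega>\<^sub>k\<^sub>+\<^sub>1\<close> are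
  multiples of \<open>du\<^sup>j - du\<^sup>i\<close>, as the next equation demands.  This in turn makes the one-forms
  \<open>\<sigma>\<^sub>i = (R\<^sub>k\<^sub>+\<^sub>1 A)\<^sub>i\<^sub>i\<close> closed (\<open>diag_form_closed\<close>).  They are homogeneous of degree \<open>-(k+1)\<close>, so by Cartan's
  formula \<open>-(k+1) \<sigma>\<^sub>i = d(\<sigma>\<^sub>i(E)) = (k+1) d(R\<^sub>k\<^sub>+\<^sub>1)\<^sub>i\<^sub>i\<close>, that is, the diagonal of \<open>\<omega>\<^sub>k\<^sub>+\<^sub>1\<close> vanishes
  (\<open>next_coeff_step\<close>).

  These computations use that the \<open>\<partial>\<^sub>a\<close> are commuting derivations of the algebra of holomorphic
  functions.  With holomorphy defined as complex differentiability, this rests on a Cauchy integral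
  for directional derivatives (\<open>Cauchy_directional_derivative\<close>) and on the inverse chart.
\<close>

section \<open>Calculus of holomorphic functions of several variables\<close>

lemma holomorphic_fun_on_iff:
  fixes f :: "complex^'n \<Rightarrow> complex"
  shows "holomorphic_fun_on f S \<longleftrightarrow> open S \<and> (\<forall>p\<in>S. f differentiable (at p) \<and>
     (\<forall>c v. frechet_derivative f (at p) (c *s v) = c * frechet_derivative f (at p) v))"
proof -
  have "(\<exists>f'. (f has_derivative f') (at p) \<and> Vector_Spaces.linear (*s) (*) f') \<longleftrightarrow>
     f differentiable (at p) \<and>
     (\<forall>c v. frechet_derivative f (at p) (c *s v) = c * frechet_derivative f (at p) v)" for p
  proof
    assume "\<exists>f'. (f has_derivative f') (at p) \<and> Vector_Spaces.linear (*s) (*) f'"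
    then obtain f' where f': "(f has_derivative f') (at p)" "Vector_Spaces.linear (*s) (*) f'" by blast
    then show "f differentiable (at p) \<and>
     (\<forall>c v. frechet_derivative f (at p) (c *s v) = c * frechet_derivative f (at p) v)"
      by (auto simp: differentiable_def Vector_Spaces.linear_iff simp flip: frechet_derivative_at[OF f'(1)])
  next
    assume h: "f differentiable (at p) \<and>
     (\<forall>c v. frechet_derivative f (at p) (c *s v) = c * frechet_derivative f (at p) v)"
    then have d: "(f has_derivative frechet_derivative f (at p)) (at p)"
      using frechet_derivative_works by blast
    have "Vector_Spaces.linear (*s) (*) (frechet_derivative f (at p))"
      using h has_derivative_linear[OF d]
      by (auto simp: Vector_Spaces.linear_iff linear_add vector_space_def vec.vector_space_axioms
            distrib_left distrib_right vec.scale_right_distrib vec.scale_left_distrib)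
    then show "\<exists>f'. (f has_derivative f') (at p) \<and> Vector_Spaces.linear (*s) (*) f'"
      using d by blast
  qed
  then show ?thesis by (simp add: holomorphic_fun_on_def)
qed

lemma holomorphic_fun_onI:
  fixes f :: "complex^'n \<Rightarrow> complex"
  assumes "open S" "\<And>p. p \<in> S \<Longrightarrow> (f has_derivative F p) (at p)"
    and "\<And>p c v. p \<in> S \<Longrightarrow> F p (c *s v) = c * F p v"
  shows "holomorphic_fun_on f S"
proof -
  have "frechet_derivative f (at p) = F p" if "p \<in> S" for p
    using frechet_derivative_at[OF assms(2)[OF that]] by simp
  then show ?thesis
    unfolding holomorphic_fun_on_iff using assms by (auto simp: differentiable_def)
qed

lemma holomorphic_fun_on_open: "holomorphic_fun_on f S \<Longrightarrow> open S"
  by (simp add: holomorphic_fun_on_def)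

lemma holomorphic_fun_on_has_derivative:
  "holomorphic_fun_on f S \<Longrightarrow> p \<in> S \<Longrightarrow> (f has_derivative frechet_derivative f (at p)) (at p)"
  by (auto simp: holomorphic_fun_on_iff simp flip: frechet_derivative_works)

lemma holomorphic_fun_on_scale:
  "holomorphic_fun_on f S \<Longrightarrow> p \<in> S \<Longrightarrow>
    frechet_derivative f (at p) (c *s v) = c * frechet_derivative f (at p) v"
  by (auto simp: holomorphic_fun_on_iff)

lemma holomorphic_fun_on_sum_vector:
  "holomorphic_fun_on f S \<Longrightarrow> p \<in> S \<Longrightarrow>
    frechet_derivative f (at p) (\<Sum>a\<in>A. c a *s v a) = (\<Sum>a\<in>A. c a * frechet_derivative f (at p) (v a))"
  by (subst linear_sum[OF has_derivative_linear[OF holomorphic_fun_on_has_derivative]])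
    (auto simp: holomorphic_fun_on_scale)

lemma holomorphic_fun_on_continuous: "holomorphic_fun_on f S \<Longrightarrow> continuous_on S f"
  by (meson continuous_at_imp_continuous_on has_derivative_continuous holomorphic_fun_on_has_derivative)

lemma holomorphic_fun_on_subset:
  "holomorphic_fun_on f S \<Longrightarrow> open T \<Longrightarrow> T \<subseteq> S \<Longrightarrow> holomorphic_fun_on f T"
  by (auto simp: holomorphic_fun_on_def)

lemma frechet_derivative_cong_on:
  assumes "open S" "p \<in> S" "\<And>x. x \<in> S \<Longrightarrow> f x = g x"
  shows "frechet_derivative f (at p) = frechet_derivative g (at p)"
proof -
  have "(f has_derivative D) (at p) \<longleftrightarrow> (g has_derivative D) (at p)" for D
    using assms by (metis has_derivative_transform_within_open)
  then show ?thesis by (simp add: frechet_derivative_def)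
qed

lemma holomorphic_fun_on_cong:
  assumes "\<And>x. x \<in> S \<Longrightarrow> f x = g x"
  shows "holomorphic_fun_on f S \<longleftrightarrow> holomorphic_fun_on g S"
proof -
  have "(f has_derivative D) (at p) \<longleftrightarrow> (g has_derivative D) (at p)" if "open S" "p \<in> S" for p D
    using has_derivative_transform_within_open[OF _ that, of f D UNIV g]
      has_derivative_transform_within_open[OF _ that, of g D UNIV f] assms by auto
  then show ?thesis by (auto simp: holomorphic_fun_on_def)
qed

lemma holomorphic_fun_on_const: "open S \<Longrightarrow> holomorphic_fun_on (\<lambda>_. c) S"
  by (rule holomorphic_fun_onI[where F="\<lambda>_ _. 0"]) auto

lemma holomorphic_fun_on_add:
  assumes "holomorphic_fun_on f S" "holomorphic_fun_on g S"
  shows "holomorphic_fun_on (\<lambda>x. f x + g x) S"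
  by (rule holomorphic_fun_onI[where F="\<lambda>p v. frechet_derivative f (at p) v + frechet_derivative g (at p) v"])
    (auto simp: assms holomorphic_fun_on_scale[OF assms(1)] holomorphic_fun_on_scale[OF assms(2)]
      distrib_left holomorphic_fun_on_open[OF assms(1)]
      intro!: has_derivative_add holomorphic_fun_on_has_derivative[OF assms(1)]
        holomorphic_fun_on_has_derivative[OF assms(2)])

lemma holomorphic_fun_on_mult:
  assumes "holomorphic_fun_on f S" "holomorphic_fun_on g S"
  shows "holomorphic_fun_on (\<lambda>x. f x * g x) S"
  by (rule holomorphic_fun_onI[where
      F="\<lambda>p v. f p * frechet_derivative g (at p) v + frechet_derivative f (at p) v * g p"])
    (auto simp: assms holomorphic_fun_on_scale[OF assms(1)] holomorphic_fun_on_scale[OF assms(2)]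
      algebra_simps holomorphic_fun_on_open[OF assms(1)]
      intro!: has_derivative_mult[THEN has_derivative_eq_rhs] holomorphic_fun_on_has_derivative[OF assms(1)]
        holomorphic_fun_on_has_derivative[OF assms(2)])

lemma holomorphic_fun_on_sum:
  assumes "open S" "finite A" "\<And>a. a \<in> A \<Longrightarrow> holomorphic_fun_on (f a) S"
  shows "holomorphic_fun_on (\<lambda>x. \<Sum>a\<in>A. f a x) S"
  using assms(2,3)
  by (induction A rule: finite_induct) (auto simp: assms(1) holomorphic_fun_on_const intro!: holomorphic_fun_on_add)

lemma holomorphic_fun_on_minus:
  assumes "holomorphic_fun_on f S" shows "holomorphic_fun_on (\<lambda>x. - f x) S"
  using holomorphic_fun_on_mult[OF holomorphic_fun_on_const[of S "-1"] assms] holomorphic_fun_on_open[OF assms]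
  by simp

lemma holomorphic_fun_on_diff:
  assumes "holomorphic_fun_on f S" "holomorphic_fun_on g S"
  shows "holomorphic_fun_on (\<lambda>x. f x - g x) S"
  using holomorphic_fun_on_add[OF assms(1) holomorphic_fun_on_minus[OF assms(2)]] by simp

lemma holomorphic_fun_on_inverse:
  assumes "holomorphic_fun_on f S" "\<And>x. x \<in> S \<Longrightarrow> f x \<noteq> 0"
  shows "holomorphic_fun_on (\<lambda>x. inverse (f x)) S"
  by (rule holomorphic_fun_onI[where
      F="\<lambda>p v. - (inverse (f p) * frechet_derivative f (at p) v * inverse (f p))"])
    (auto simp: assms holomorphic_fun_on_scale[OF assms(1)] 
      algebra_simps holomorphic_fun_on_open[OF assms(1)]
      intro!: Deriv.has_derivative_inverse[THEN has_derivative_eq_rhs] holomorphic_fun_on_has_derivative[OF assms(1)])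

lemma has_derivative_vecI:
  fixes X :: "'a::real_normed_vector \<Rightarrow> complex^'m"
  assumes "\<And>i. ((\<lambda>x. X x $ i) has_derivative (\<lambda>v. X' v $ i)) (at p)"
  shows "(X has_derivative X') (at p)"
proof -
  have "((\<lambda>x. X x \<bullet> b) has_derivative (\<lambda>v. X' v \<bullet> b)) (at p)" if "b \<in> Basis" for b
  proof -
    obtain i c where b: "b = axis i c" using \<open>b \<in> Basis\<close> by (auto simp: Basis_vec_def)
    show ?thesis unfolding b inner_axis by (intro has_derivative_inner_left assms)
  qed
  then show ?thesis by (subst has_derivative_componentwise_within) auto
qed

lemma has_derivative_matI:
  fixes X :: "'a::real_normed_vector \<Rightarrow> complex^'m^'k"
  assumes "\<And>i j. ((\<lambda>x. X x $ i $ j) has_derivative (\<lambda>v. X' v $ i $ j)) (at p)"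
  shows "(X has_derivative X') (at p)"
proof -
  have "((\<lambda>x. X x \<bullet> b) has_derivative (\<lambda>v. X' v \<bullet> b)) (at p)" if "b \<in> Basis" for b
  proof -
    obtain i c where b: "b = axis i c" using \<open>b \<in> Basis\<close> by (auto simp: Basis_vec_def)
    show ?thesis unfolding b inner_axis
      by (intro has_derivative_inner_left has_derivative_vecI assms)
  qed
  then show ?thesis by (subst has_derivative_componentwise_within) auto
qed

lemma frechet_derivative_vec:
  assumes "holomorphic_vec_on X S" "p \<in> S"
  shows "(X has_derivative frechet_derivative X (at p)) (at p)"
    and "frechet_derivative X (at p) v $ i = frechet_derivative (\<lambda>x. X x $ i) (at p) v"
proof -
  have "(X has_derivative (\<lambda>v. \<chi> i. frechet_derivative (\<lambda>x. X x $ i) (at p) v)) (at p)"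
    by (rule has_derivative_vecI) 
      (use assms in \<open>auto simp: holomorphic_vec_on_def intro!: holomorphic_fun_on_has_derivative\<close>)
  then show "(X has_derivative frechet_derivative X (at p)) (at p)"
    and "frechet_derivative X (at p) v $ i = frechet_derivative (\<lambda>x. X x $ i) (at p) v"
    by (simp_all flip: frechet_derivative_at)
qed

lemma frechet_derivative_mat:
  assumes "holomorphic_mat_on X S" "p \<in> S"
  shows "frechet_derivative X (at p) v $ i $ j = frechet_derivative (\<lambda>x. X x $ i $ j) (at p) v"
proof -
  have "(X has_derivative (\<lambda>v. \<chi> i j. frechet_derivative (\<lambda>x. X x $ i $ j) (at p) v)) (at p)"
    by (rule has_derivative_matI) 
      (use assms in \<open>auto simp: holomorphic_mat_on_def intro!: holomorphic_fun_on_has_derivative\<close>)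
  then show ?thesis
    by (simp flip: frechet_derivative_at)
qed

lemma holomorphic_fun_on_compose:
  assumes f: "holomorphic_fun_on f S" and X: "holomorphic_vec_on X T" and sub: "X ` T \<subseteq> S" and T: "open T"
  shows "holomorphic_fun_on (\<lambda>x. f (X x)) T"
    and "p \<in> T \<Longrightarrow> frechet_derivative (\<lambda>x. f (X x)) (at p) v
          = frechet_derivative f (at (X p)) (frechet_derivative X (at p) v)"
proof -
  have d: "((\<lambda>x. f (X x)) has_derivative
      (\<lambda>v. frechet_derivative f (at (X p)) (frechet_derivative X (at p) v))) (at p)" if "p \<in> T" for p
    using has_derivative_compose[OF frechet_derivative_vec(1)[OF X that]
        holomorphic_fun_on_has_derivative[OF f, of "X p"]] that sub by auto
  show "holomorphic_fun_on (\<lambda>x. f (X x)) T"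
  proof (rule holomorphic_fun_onI[OF T d])
    fix p c v assume p: "p \<in> T"
    have "frechet_derivative X (at p) (c *s v) = c *s frechet_derivative X (at p) v"
      using X p unfolding vec_eq_iff
      by (auto simp: frechet_derivative_vec(2)[OF X p] holomorphic_vec_on_def intro!: holomorphic_fun_on_scale)
    then show "frechet_derivative f (at (X p)) (frechet_derivative X (at p) (c *s v)) =
       c * frechet_derivative f (at (X p)) (frechet_derivative X (at p) v)"
      using p sub by (auto simp: holomorphic_fun_on_scale[OF f])
  qed auto
  show "p \<in> T \<Longrightarrow> frechet_derivative (\<lambda>x. f (X x)) (at p) v
          = frechet_derivative f (at (X p)) (frechet_derivative X (at p) v)"
    by (simp flip: frechet_derivative_at[OF d])
qed

section \<open>Directional derivatives of holomorphic functions\<close>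

text \<open>
  This is Cauchy's formula for the derivative at \<open>0\<close> of \<open>\<zeta> \<mapsto> f (p + \<zeta> v)\<close>.  In the parametrization by
  \<open>circlepath\<close> the factor \<open>2\<pi>\<i>\<close> cancels against the derivative of the path, and one power of \<open>\<zeta>\<close>
  remains in the denominator.
\<close>

lemma Cauchy_directional_derivative:
  assumes f: "holomorphic_fun_on f S" and r: "r > 0"
    and disc: "\<And>\<zeta>. cmod \<zeta> \<le> r \<Longrightarrow> p + \<zeta> *s v \<in> S"
  shows "((\<lambda>t. f (p + circlepath 0 r t *s v) / circlepath 0 r t) has_integral
            frechet_derivative f (at p) v) (cbox 0 (1::real))"
proof -
  define g where "g \<zeta> = f (p + \<zeta> *s v)" for \<zeta>
  have g': "(g has_field_derivative frechet_derivative f (at (p + \<zeta> *s v)) v) (at \<zeta>)"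
    if "cmod \<zeta> \<le> r" for \<zeta>
  proof -
    have "((\<lambda>\<zeta>. p + \<zeta> *s v) has_derivative (\<lambda>\<zeta>. \<zeta> *s v)) (at \<zeta>)"
    proof (rule has_derivative_vecI)
      fix i
      have "((\<lambda>\<zeta>. p $ i + \<zeta> * v $ i) has_derivative (\<lambda>\<zeta>. 0 + \<zeta> * v $ i)) (at \<zeta>)"
        by (intro has_derivative_add has_derivative_const has_derivative_mult_left has_derivative_ident)
      then show "((\<lambda>\<zeta>. (p + \<zeta> *s v) $ i) has_derivative (\<lambda>\<zeta>. (\<zeta> *s v) $ i)) (at \<zeta>)"
        by simp
    qed
    from has_derivative_compose[OF this holomorphic_fun_on_has_derivative[OF f disc[OF that]]]
    show ?thesis
      unfolding has_field_derivative_def g_def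
      by (rule has_derivative_eq_rhs) (simp add: fun_eq_iff holomorphic_fun_on_scale[OF f disc[OF that]])
  qed
  have cont: "continuous_on (cball 0 r) g"
    by (intro continuous_at_imp_continuous_on ballI) (use g' in \<open>auto intro: DERIV_isCont\<close>)
  have hol: "g holomorphic_on ball 0 r"
    unfolding holomorphic_on_open[OF open_ball] by (metis g' less_imp_le mem_ball_0)
  have "((\<lambda>\<zeta>. g \<zeta> / (\<zeta> - 0) ^ Suc 1) has_contour_integral (2 * pi * \<i>) / fact 1 * (deriv ^^ 1) g 0) (circlepath 0 r)"
    by (rule Cauchy_has_contour_integral_higher_derivative_circlepath[OF cont hol]) (use r in auto)
  moreover have "deriv g 0 = frechet_derivative f (at p) v"
    using DERIV_imp_deriv[OF g'[of 0]] r by simp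
  ultimately have "((\<lambda>t. g (circlepath 0 r t) / circlepath 0 r t ^ 2 * vector_derivative (circlepath 0 r) (at t))
      has_integral (2 * pi * \<i>) * frechet_derivative f (at p) v) {0..1}"
    by (simp add: has_contour_integral power2_eq_square)
  then have "((\<lambda>t. (1 / (2 * pi * \<i>)) * (g (circlepath 0 r t) / circlepath 0 r t ^ 2 * vector_derivative (circlepath 0 r) (at t)))
      has_integral (1 / (2 * pi * \<i>)) * ((2 * pi * \<i>) * frechet_derivative f (at p) v)) {0..1}"
    by (rule has_integral_mult_right)
  moreover have "vector_derivative (circlepath 0 r) (at t) = 2 * pi * \<i> * circlepath 0 r t" for t
    by (subst vector_derivative_circlepath) (simp add: circlepath)
  then have "(1 / (2 * pi * \<i>)) * (g (circlepath 0 r t) / circlepath 0 r t ^ 2 * vector_derivative (circlepath 0 r) (at t))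
      = g (circlepath 0 r t) / circlepath 0 r t" for t
    using r by (simp add: circlepath power2_eq_square)
  ultimately show ?thesis by (simp add: g_def)
qed

text \<open>
  To vary the centre \<open>q\<close> in the integral formula one radius has to serve all \<open>q\<close> near \<open>p\<close>.
\<close>

lemma uniform_disc_radius:
  fixes p v :: "complex^'n"
  assumes "open S" "p \<in> S"
  obtains r d where "r > 0" "d > 0" "ball p d \<subseteq> S"
    "\<And>q \<zeta>. q \<in> ball p d \<Longrightarrow> cmod \<zeta> \<le> r \<Longrightarrow> q + \<zeta> *s v \<in> S"
proof -
  obtain d where d: "d > 0" "ball p (2 * d) \<subseteq> S"
    using assms by (metis half_gt_zero open_contains_ball_eq mult_2 field_sum_of_halves)
  have n: "norm (\<zeta> *s v) = cmod \<zeta> * norm v" for \<zeta> :: complex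
    by (simp add: norm_vec_def norm_mult L2_set_right_distrib)
  define r where "r = d / (norm v + 1)"
  have "r > 0" using d by (simp add: r_def add_nonneg_pos)
  moreover have "r * norm v < d" using d
    by (simp add: r_def pos_divide_less_eq add_nonneg_pos distrib_left)
  ultimately have "q + \<zeta> *s v \<in> S" if "q \<in> ball p d" "cmod \<zeta> \<le> r" for q \<zeta>
  proof -
    have "norm (\<zeta> *s v) < d"
      using n[of \<zeta>] \<open>r * norm v < d\<close> that(2) mult_right_mono[OF that(2), of "norm v"] by simp
    then have "dist p (q + \<zeta> *s v) < 2 * d"
      using that(1) norm_triangle_ineq4[of "p - q" "\<zeta> *s v"] by (simp add: dist_norm algebra_simps)
    then show ?thesis using d(2) by auto
  qed
  moreover have "ball p d \<subseteq> S" using d by auto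
  ultimately show ?thesis using that \<open>r > 0\<close> d(1) by blast
qed

text \<open>
  Differentiability only gives continuity of \<open>f\<close>.  The integral formula transfers it to the
  derivative, and this is what differentiation under the integral sign requires.
\<close>

lemma continuous_on_directional_derivative:
  assumes f: "holomorphic_fun_on f S"
  shows "continuous_on S (\<lambda>p. frechet_derivative f (at p) v)"
proof (intro continuous_at_imp_continuous_on ballI)
  fix p assume "p \<in> S"
  then obtain r d where rd: "r > 0" "d > 0" "ball p d \<subseteq> S"
    "\<And>q \<zeta>. q \<in> ball p d \<Longrightarrow> cmod \<zeta> \<le> r \<Longrightarrow> q + \<zeta> *s v \<in> S"
    using uniform_disc_radius[OF holomorphic_fun_on_open[OF f]] by metis
  have on_circle: "cmod (circlepath 0 r t) \<le> r" "circlepath 0 r t \<noteq> 0" for t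
    using rd(1) by (auto simp: circlepath norm_mult)
  have "continuous_on (ball p d \<times> cbox 0 1) (\<lambda>(q, t). f (q + circlepath 0 r t *s v) / circlepath 0 r t)"
    unfolding split_beta
    by (intro continuous_intros continuous_on_compose2[OF holomorphic_fun_on_continuous[OF f]])
      (use on_circle rd in \<open>auto simp: circlepath vector_scalar_mult_def intro!: continuous_intros\<close>)
  then have "continuous_on (ball p d) (\<lambda>q. integral (cbox 0 1) (\<lambda>t. f (q + circlepath 0 r t *s v) / circlepath 0 r t))"
    by (rule integral_continuous_on_param)
  moreover have "integral (cbox 0 1) (\<lambda>t. f (q + circlepath 0 r t *s v) / circlepath 0 r t)
      = frechet_derivative f (at q) v" if "q \<in> ball p d" for q
    by (rule integral_unique[OF Cauchy_directional_derivative[OF f rd(1) rd(4)[OF that]]])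
  ultimately have "continuous_on (ball p d) (\<lambda>q. frechet_derivative f (at q) v)"
    by (auto elim!: continuous_on_cong[THEN iffD1, rotated 2])
  then show "isCont (\<lambda>p. frechet_derivative f (at p) v) p"
    using rd(2) by (auto simp: continuous_on_eq_continuous_at)
qed

text \<open>
  The derivative \<open>D\<close> is given by an integral of derivatives of \<open>f\<close> on a circle.  Both complex linearity of
  \<open>D\<close> and the symmetry of second derivatives are read off from this formula.
\<close>

lemma directional_derivative_has_derivative:
  assumes f: "holomorphic_fun_on f S" and p: "p \<in> S"
  obtains r D where "r > 0" "\<And>\<zeta>. cmod \<zeta> \<le> r \<Longrightarrow> p + \<zeta> *s v \<in> S"
    "((\<lambda>p. frechet_derivative f (at p) v) has_derivative D) (at p)"
    "\<And>w. ((\<lambda>t. frechet_derivative f (at (p + circlepath 0 r t *s v)) w / circlepath 0 r t)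
        has_integral D w) (cbox 0 1)"
proof -
  obtain r d where rd: "r > 0" "d > 0" "ball p d \<subseteq> S"
    "\<And>q \<zeta>. q \<in> ball p d \<Longrightarrow> cmod \<zeta> \<le> r \<Longrightarrow> q + \<zeta> *s v \<in> S"
    using uniform_disc_radius[OF holomorphic_fun_on_open[OF f] p] by metis
  have on_circle: "cmod (circlepath 0 r t) \<le> r" "circlepath 0 r t \<noteq> 0" for t
    using rd(1) by (auto simp: circlepath norm_mult)
  define L where "L q t = Blinfun (\<lambda>w. frechet_derivative f (at (q + circlepath 0 r t *s v)) w / circlepath 0 r t)"
    for q t
  have L: "blinfun_apply (L q t) = (\<lambda>w. frechet_derivative f (at (q + circlepath 0 r t *s v)) w / circlepath 0 r t)"
    if "q \<in> ball p d" for q t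
    unfolding L_def
    by (intro bounded_linear_Blinfun_apply bounded_linear_divide[THEN bounded_linear_compose]
        has_derivative_bounded_linear[OF holomorphic_fun_on_has_derivative[OF f]] rd(4) that on_circle)
  have cont: "continuous_on (ball p d \<times> cbox 0 1) (\<lambda>(q, t). L q t)"
  proof (rule continuous_on_blinfun_componentwise)
    fix w :: "complex^'a" 
    have "continuous_on (ball p d \<times> cbox 0 1)
      (\<lambda>(q, t). frechet_derivative f (at (q + circlepath 0 r t *s v)) w / circlepath 0 r t)"
      unfolding split_beta
      by (intro continuous_intros continuous_on_compose2[OF continuous_on_directional_derivative[OF f]])
        (use on_circle rd in \<open>auto simp: circlepath vector_scalar_mult_def intro!: continuous_intros\<close>)
    then show "continuous_on (ball p d \<times> cbox 0 1) (\<lambda>x. blinfun_apply (case x of (q, t) \<Rightarrow> L q t) w)"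
      by (rule continuous_on_cong[THEN iffD1, rotated 2]) (auto simp: L)
  qed
  have "((\<lambda>q. integral (cbox 0 1) (\<lambda>t. f (q + circlepath 0 r t *s v) / circlepath 0 r t))
      has_derivative integral (cbox 0 1) (L p)) (at p within ball p d)"
  proof (rule leibniz_rule[OF _ _ cont])
    fix q t assume q: "q \<in> ball p d"
    have "((\<lambda>q. q + circlepath 0 r t *s v) has_derivative (\<lambda>w. w + 0)) (at q within ball p d)"
      by (intro has_derivative_add has_derivative_const has_derivative_ident)
    from has_derivative_compose[OF this holomorphic_fun_on_has_derivative[OF f rd(4)[OF q on_circle(1)]], unfolded add_0_right]
    show "((\<lambda>q. f (q + circlepath 0 r t *s v) / circlepath 0 r t) has_derivative blinfun_apply (L q t)) (at q within ball p d)"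
      unfolding L[OF q] by (rule bounded_linear.has_derivative[OF bounded_linear_divide])
  next
    fix q assume "q \<in> ball p d"
    then show "(\<lambda>t. f (q + circlepath 0 r t *s v) / circlepath 0 r t) integrable_on cbox 0 1"
      by (rule has_integral_integrable[OF Cauchy_directional_derivative[OF f rd(1) rd(4)]])
  qed (use rd(2) in auto)
  then have D': "((\<lambda>q. integral (cbox 0 1) (\<lambda>t. f (q + circlepath 0 r t *s v) / circlepath 0 r t))
      has_derivative integral (cbox 0 1) (L p)) (at p)"
    by (simp only: at_within_open[of p "ball p d"] open_ball centre_in_ball rd(2))
  have Cauchy: "integral (cbox 0 1) (\<lambda>t. f (q + circlepath 0 r t *s v) / circlepath 0 r t)
      = frechet_derivative f (at q) v" if "q \<in> ball p d" for q
    by (rule integral_unique[OF Cauchy_directional_derivative[OF f rd(1) rd(4)[OF that]]])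
  have D: "((\<lambda>q. frechet_derivative f (at q) v) has_derivative integral (cbox 0 1) (L p)) (at p)"
    by (rule has_derivative_transform_within_open[OF D' open_ball _ Cauchy]) (use rd(2) in auto)
  have "L p integrable_on cbox 0 1"
    by (intro integrable_continuous continuous_on_compose2[OF cont, where f="\<lambda>t. (p, t)", simplified] continuous_intros)
      (use rd(2) in auto)
  then have "((\<lambda>t. blinfun_apply (L p t) w) has_integral blinfun_apply (integral (cbox 0 1) (L p)) w) (cbox 0 1)" for w
    using has_integral_linear[OF integrable_integral bounded_linear_apply_blinfun[of w], of "L p" "cbox 0 1"]
    by (simp add: o_def)
  with D show ?thesis
    by (intro that[of r "blinfun_apply (integral (cbox 0 1) (L p))"] rd(1) rd(4)) (use rd(2) in \<open>auto simp: L\<close>)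
qed

lemma directional_derivative_holomorphic:
  assumes f: "holomorphic_fun_on f S"
  shows "holomorphic_fun_on (\<lambda>p. frechet_derivative f (at p) v) S"
  unfolding holomorphic_fun_on_iff
proof (intro conjI ballI allI holomorphic_fun_on_open[OF f])
  fix p assume p: "p \<in> S"
  let ?f = "\<lambda>p. frechet_derivative f (at p) v"
  obtain r D where D: "r > 0" "\<And>\<zeta>. cmod \<zeta> \<le> r \<Longrightarrow> p + \<zeta> *s v \<in> S"
    "(?f has_derivative D) (at p)"
    "\<And>w. ((\<lambda>t. frechet_derivative f (at (p + circlepath 0 r t *s v)) w / circlepath 0 r t)
        has_integral D w) (cbox 0 1)"
    using directional_derivative_has_derivative[OF f p] by blast
  then show "?f differentiable at p" by (auto simp: differentiable_def)
  fix c w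
  have "cmod (circlepath 0 r t) \<le> r" for t
    using D(1) by (auto simp: circlepath norm_mult)
  then have "((\<lambda>t. c * (frechet_derivative f (at (p + circlepath 0 r t *s v)) w / circlepath 0 r t))
        has_integral D (c *s w)) (cbox 0 1)"
    using D(4)[of "c *s w"] by (simp add: holomorphic_fun_on_scale[OF f D(2)])
  from has_integral_unique[OF this has_integral_mult_right[OF D(4)[of w]]]
  have "D (c *s w) = c * D w" .
  then show "frechet_derivative ?f (at p) (c *s w) = c * frechet_derivative ?f (at p) w"
    by (simp flip: frechet_derivative_at[OF D(3)])
qed

text \<open>
  Differentiating the Cauchy integral of \<open>f\<close> along \<open>v\<close> in the direction \<open>w\<close> gives the Cauchy integral
  along \<open>v\<close> of the derivative of \<open>f\<close> in the direction \<open>w\<close>.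
\<close>

lemma directional_derivatives_commute:
  assumes f: "holomorphic_fun_on f S" and p: "p \<in> S"
  shows "frechet_derivative (\<lambda>p. frechet_derivative f (at p) v) (at p) w
       = frechet_derivative (\<lambda>p. frechet_derivative f (at p) w) (at p) v"
proof -
  obtain r D where D: "r > 0" "\<And>\<zeta>. cmod \<zeta> \<le> r \<Longrightarrow> p + \<zeta> *s v \<in> S"
    "((\<lambda>p. frechet_derivative f (at p) v) has_derivative D) (at p)"
    "\<And>w. ((\<lambda>t. frechet_derivative f (at (p + circlepath 0 r t *s v)) w / circlepath 0 r t)
        has_integral D w) (cbox 0 1)"
    using directional_derivative_has_derivative[OF f p] by blast
  have "D w = frechet_derivative (\<lambda>p. frechet_derivative f (at p) w) (at p) v"
    using has_integral_unique[OF D(4)[of w]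
        Cauchy_directional_derivative[OF directional_derivative_holomorphic[OF f] D(1,2)]] .
  then show ?thesis by (simp flip: frechet_derivative_at[OF D(3)])
qed

section \<open>The coordinate fields of a holomorphic chart\<close>

locale holomorphic_chart =
  fixes V :: "(complex^'n::finite) set" and u :: "complex^'n \<Rightarrow> complex^'n"
  assumes open_domain: "open V" and coordinates: "coordinates_on u V"
begin

abbreviation hol :: "(complex^'n \<Rightarrow> complex) \<Rightarrow> bool" where
  "hol f \<equiv> holomorphic_fun_on f V"

lemma coordinate_hol: "hol (\<lambda>p. u p $ i)"
  using coordinates by (simp add: coordinates_on_def holomorphic_vec_on_def)

lemma differential_coord_vf:
  assumes "p \<in> V"
  shows "frechet_derivative u (at p) (coord_vf u k p) = axis k 1"
  using coordinates assms by (auto simp: coordinates_on_def coord_vf_def bij_is_surj surj_f_inv_f)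

lemma partial_coordinate:
  assumes "p \<in> V"
  shows "coord_partial u k (\<lambda>x. u x $ i) p = (if i = k then 1 else 0)"
  using frechet_derivative_vec(2)[of u V p "coord_vf u k p" i] assms coordinates
  by (simp add: coord_partial_def coordinates_on_def differential_coord_vf axis_def)

lemma vector_expansion:
  assumes "p \<in> V"
  shows "v = (\<Sum>k\<in>UNIV. frechet_derivative (\<lambda>x. u x $ k) (at p) v *s coord_vf u k p)"
proof -
  have "frechet_derivative u (at p) v = frechet_derivative u (at p)
      (\<Sum>k\<in>UNIV. frechet_derivative (\<lambda>x. u x $ k) (at p) v *s coord_vf u k p)"
    using coordinates assms
    by (simp add: vec_eq_iff frechet_derivative_vec(2)[of u V p] coordinates_on_def
        holomorphic_fun_on_sum_vector[OF coordinate_hol] partial_coordinate[unfolded coord_partial_def]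
        if_distrib[of "\<lambda>x. _ * x"] cong: if_cong)
  then show ?thesis
    using coordinates assms by (auto simp: coordinates_on_def dest!: bspec[of V _ p] bij_is_inj[THEN injD])
qed

lemma differential_expansion:
  assumes "hol f" "p \<in> V"
  shows "frechet_derivative f (at p) v =
    (\<Sum>k\<in>UNIV. frechet_derivative (\<lambda>x. u x $ k) (at p) v * coord_partial u k f p)"
  unfolding coord_partial_def holomorphic_fun_on_sum_vector[OF assms, symmetric]
  by (rule arg_cong[OF vector_expansion[OF assms(2)]])

text \<open>
  The inverse of a chart carries the constant vectors to the fields \<open>coord_vf u k\<close>; this reduces
  statements on \<open>coord_partial\<close> to constant directions.
\<close>

lemma inverse_chart:
  obtains x where "open (u ` V)" "holomorphic_vec_on x (u ` V)" "x ` (u ` V) = V"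
    "\<And>p. p \<in> V \<Longrightarrow> x (u p) = p"
    "\<And>p k. p \<in> V \<Longrightarrow> frechet_derivative x (at (u p)) (axis k 1) = coord_vf u k p"
proof
  let ?x = "inv_into V u"
  have hol: "holomorphic_vec_on u V" and inj: "inj_on u V"
    using coordinates by (auto simp: coordinates_on_def)
  have cont: "continuous_on V u"
    using frechet_derivative_vec(1)[OF hol]
    by (meson continuous_at_imp_continuous_on has_derivative_continuous)
  show op: "open (u ` V)"
    using invariance_of_domain[OF cont open_domain inj] .
  show inv: "?x (u p) = p" if "p \<in> V" for p
    using inj that by simp
  show "?x ` (u ` V) = V"
    using inj by (simp add: image_inv_into_cancel image_image)
  have d: "(?x has_derivative inv (frechet_derivative u (at p))) (at (u p))" if "p \<in> V" for p
    by (rule has_derivative_inverse_strong[OF open_domain that cont inv frechet_derivative_vec(1)[OF hol that]])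
      (use coordinates that in \<open>auto simp: coordinates_on_def fun_eq_iff bij_is_surj surj_f_inv_f\<close>)
  have scale: "inv (frechet_derivative u (at p)) (c *s v) = c *s inv (frechet_derivative u (at p)) v"
    if "p \<in> V" for p c v
  proof -
    have bij: "bij (frechet_derivative u (at p))"
      using coordinates that by (auto simp: coordinates_on_def)
    have "frechet_derivative u (at p) (c *s w) = c *s frechet_derivative u (at p) w" for w
      by (simp add: vec_eq_iff frechet_derivative_vec(2)[OF hol that] holomorphic_fun_on_scale[OF coordinate_hol that])
    then show ?thesis using bij
      by (metis bij_inv_eq_iff)
  qed
  show "holomorphic_vec_on ?x (u ` V)"
    unfolding holomorphic_vec_on_def
  proof (intro allI holomorphic_fun_onI[OF op])
    fix i y assume y: "y \<in> u ` V"
    then have "(?x has_derivative inv (frechet_derivative u (at (?x y)))) (at y)"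
      using d inv by auto
    then show "((\<lambda>y. ?x y $ i) has_derivative (\<lambda>v. inv (frechet_derivative u (at (?x y))) v $ i)) (at y)"
      by (rule bounded_linear.has_derivative[OF bounded_linear_vec_nth])
    show "inv (frechet_derivative u (at (?x y))) (c *s v) $ i = c * inv (frechet_derivative u (at (?x y))) v $ i" for c v
      using y scale inv by auto
  qed
  show "frechet_derivative ?x (at (u p)) (axis k 1) = coord_vf u k p" if "p \<in> V" for p k
    using d[OF that] by (simp add: coord_vf_def flip: frechet_derivative_at)
qed

text \<open>
  Pulled back by the inverse chart, \<open>coord_partial u k\<close> is the derivative in the constant direction
  \<open>axis k 1\<close>.
\<close>

lemma partial_hol:
  assumes f: "hol f"
  shows "hol (coord_partial u k f)"
    and "p \<in> V \<Longrightarrow> coord_partial u l (coord_partial u k f) p = coord_partial u k (coord_partial u l f) p"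
proof -
  obtain x where x: "open (u ` V)" "holomorphic_vec_on x (u ` V)" "x ` (u ` V) = V"
    "\<And>p. p \<in> V \<Longrightarrow> x (u p) = p"
    "\<And>p k. p \<in> V \<Longrightarrow> frechet_derivative x (at (u p)) (axis k 1) = coord_vf u k p"
    using inverse_chart by blast
  have fx: "holomorphic_fun_on (\<lambda>y. g (x y)) (u ` V)" if "hol g" for g
    using holomorphic_fun_on_compose(1)[OF that x(2) _ x(1)] x(3) by simp
  have pull: "coord_partial u k g p = frechet_derivative (\<lambda>y. g (x y)) (at (u p)) (axis k 1)"
    if "hol g" "p \<in> V" for g p k
    using holomorphic_fun_on_compose(2)[OF that(1) x(2) _ x(1), of "u p" "axis k 1"] that x
    by (simp add: coord_partial_def)
  have u: "holomorphic_vec_on u V" using coordinates by (simp add: coordinates_on_def)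
  show hol: "hol (coord_partial u k f)" for k
    using holomorphic_fun_on_compose(1)[OF directional_derivative_holomorphic[OF fx[OF f], of "axis k 1"] u _ open_domain]
    by (simp add: pull[OF f] cong: holomorphic_fun_on_cong)
  assume p: "p \<in> V"
  have "coord_partial u b (coord_partial u a f) p =
      frechet_derivative (\<lambda>y. frechet_derivative (\<lambda>y. f (x y)) (at y) (axis a 1)) (at (u p)) (axis b 1)" for a b
  proof -
    have "frechet_derivative (\<lambda>y. coord_partial u a f (x y)) (at (u p)) =
      frechet_derivative (\<lambda>y. frechet_derivative (\<lambda>y. f (x y)) (at y) (axis a 1)) (at (u p))"
    proof (rule frechet_derivative_cong_on[OF x(1)])
      fix y assume "y \<in> u ` V"
      then obtain q where "q \<in> V" "y = u q" by blast
      then show "coord_partial u a f (x y) = frechet_derivative (\<lambda>y. f (x y)) (at y) (axis a 1)"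
        using x(4) pull[OF f] by simp
    qed (use p in auto)
    then show ?thesis using pull[OF hol p] by simp
  qed
  then show "coord_partial u l (coord_partial u k f) p = coord_partial u k (coord_partial u l f) p"
    using directional_derivatives_commute[OF fx[OF f]] p by simp
qed

lemma partial_const [simp]: "coord_partial u k (\<lambda>_. c) p = 0"
  by (simp add: coord_partial_def)

lemma partial_cong:
  assumes "p \<in> V" "\<And>x. x \<in> V \<Longrightarrow> f x = g x"
  shows "coord_partial u k f p = coord_partial u k g p"
  using frechet_derivative_cong_on[OF open_domain assms] by (simp add: coord_partial_def)

lemma partial_add:
  assumes "hol f" "hol g" "p \<in> V"
  shows "coord_partial u k (\<lambda>x. f x + g x) p = coord_partial u k f p + coord_partial u k g p"
  using has_derivative_add[OF holomorphic_fun_on_has_derivative[OF assms(1,3)]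
      holomorphic_fun_on_has_derivative[OF assms(2,3)]]
  by (simp add: coord_partial_def flip: frechet_derivative_at)

lemma partial_mult:
  assumes "hol f" "hol g" "p \<in> V"
  shows "coord_partial u k (\<lambda>x. f x * g x) p = coord_partial u k f p * g p + f p * coord_partial u k g p"
  using has_derivative_mult[OF holomorphic_fun_on_has_derivative[OF assms(1,3)]
      holomorphic_fun_on_has_derivative[OF assms(2,3)]]
  by (simp add: coord_partial_def flip: frechet_derivative_at)

lemma partial_cmult:
  assumes "hol f" "p \<in> V"
  shows "coord_partial u k (\<lambda>x. c * f x) p = c * coord_partial u k f p"
  using partial_mult[OF holomorphic_fun_on_const[OF open_domain] assms] by simp

lemma partial_diff:
  assumes "hol f" "hol g" "p \<in> V"
  shows "coord_partial u k (\<lambda>x. f x - g x) p = coord_partial u k f p - coord_partial u k g p"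
  using has_derivative_diff[OF holomorphic_fun_on_has_derivative[OF assms(1,3)]
      holomorphic_fun_on_has_derivative[OF assms(2,3)]]
  by (simp add: coord_partial_def flip: frechet_derivative_at)

lemma partial_sum:
  assumes "\<And>a. a \<in> A \<Longrightarrow> hol (f a)" "p \<in> V"
  shows "coord_partial u k (\<lambda>x. \<Sum>a\<in>A. f a x) p = (\<Sum>a\<in>A. coord_partial u k (f a) p)"
  using has_derivative_sum[of A f, OF holomorphic_fun_on_has_derivative[OF assms]]
  by (simp add: coord_partial_def flip: frechet_derivative_at)

end

section \<open>Matrices\<close>

lemma matrix_diff_ldistrib: "A ** (B - C) = A ** B - A ** (C :: 'a::ring_1^'n^'m)"
  by (simp add: vec_eq_iff matrix_matrix_mult_def right_diff_distrib sum_subtractf)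

lemma matrix_diff_rdistrib: "(A - B) ** C = A ** C - B ** (C :: 'a::ring_1^'n^'m)"
  by (simp add: vec_eq_iff matrix_matrix_mult_def left_diff_distrib sum_subtractf)

lemma matrix_add_rdistrib: "(A + B) ** C = A ** C + B ** (C :: 'a::ring_1^'n^'m)"
  by (simp add: vec_eq_iff matrix_matrix_mult_def distrib_right sum.distrib)

lemma matrix_mult_right_cancel:
  fixes P :: "complex^'n^'n"
  assumes "invertible P" "A ** P = B ** P"
  shows "A = B"
  using assms by (metis invertible_right_inverse matrix_mul_assoc matrix_mul_rid)

lemmas matrix_ring_simps = matrix_add_ldistrib matrix_add_rdistrib matrix_diff_ldistrib
  matrix_diff_rdistrib matrix_mul_assoc

lemma matrix_mult_nth: "(A ** B) $ i $ j = (\<Sum>l\<in>UNIV. A $ i $ l * B $ l $ j)"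
  by (simp add: matrix_matrix_mult_def)

abbreviation coord_proj :: "'n \<Rightarrow> complex^'n^'n::finite" where
  "coord_proj a \<equiv> diag_mat (axis a 1)"

lemma diag_mult_nth: "(diag_mat d ** A) $ i $ j = d $ i * A $ i $ j"
  by (simp add: matrix_mult_nth diag_mat_def if_distrib[of "\<lambda>x. x * _"] cong: if_cong)

lemma mult_diag_nth: "(A ** diag_mat d) $ i $ j = A $ i $ j * d $ j"
  by (simp add: matrix_mult_nth diag_mat_def if_distrib[of "\<lambda>x. _ * x"] cong: if_cong)

lemma commutator_diag_nth: "commutator A (diag_mat d) $ i $ j = A $ i $ j * (d $ j - d $ i)"
  by (simp add: commutator_def diag_mult_nth mult_diag_nth algebra_simps)

lemma diag_mat_commute: "diag_mat c ** diag_mat d = diag_mat d ** diag_mat (c :: complex^'n::finite)"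
  by (simp add: vec_eq_iff diag_mult_nth) (simp add: diag_mat_def)

lemma matrix_inv_diag_mat:
  fixes d :: "complex^'n::finite"
  assumes "\<And>i. d $ i \<noteq> 0"
  shows "matrix_inv (diag_mat d) = diag_mat (\<chi> i. inverse (d $ i))"
    and "matrix_inv (diag_mat d) ** diag_mat d = mat 1" "invertible (diag_mat d)"
proof -
  let ?e = "diag_mat (\<chi> i. inverse (d $ i))"
  have 1: "diag_mat d ** ?e = mat 1"
    using assms by (simp add: vec_eq_iff diag_mult_nth) (simp add: diag_mat_def mat_def)
  then show inv: "invertible (diag_mat d)" by (auto simp: invertible_right_inverse)
  have "matrix_inv (diag_mat d) ** diag_mat d = mat 1"
    using someI_ex[of "\<lambda>A'. diag_mat d ** A' = mat 1 \<and> A' ** diag_mat d = mat 1"] inv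
    by (simp add: matrix_inv_def invertible_def)
  then show "matrix_inv (diag_mat d) ** diag_mat d = mat 1" .
  then show "matrix_inv (diag_mat d) = ?e" using 1 by (metis matrix_mul_assoc matrix_mul_lid matrix_mul_rid)
qed

lemma matrix_minus_mult: "(- A) ** B = - (A ** (B :: 'a::ring_1^'n^'m))"
  by (simp add: vec_eq_iff matrix_matrix_mult_def sum_negf)

lemma matrix_inv_mult_self:
  fixes A :: "complex^'n^'n"
  assumes "invertible A" shows "matrix_inv A ** A = mat 1"
  using someI_ex[of "\<lambda>A'. A ** A' = mat 1 \<and> A' ** A = mat 1"] assms
  by (simp add: matrix_inv_def invertible_def)

lemma eq_mult_of_mult_matrix_inv:
  fixes A :: "complex^'n^'n"
  assumes "invertible A" "B ** matrix_inv A = C" shows "B = C ** A"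
  using assms matrix_inv_mult_self[OF assms(1)] by (metis matrix_mul_assoc matrix_mul_rid)

section \<open>Matrices of functions and the Euler field\<close>

context holomorphic_chart
begin

abbreviation holmat :: "(complex^'n \<Rightarrow> complex^'n^'n) \<Rightarrow> bool" where
  "holmat X \<equiv> holomorphic_mat_on X V"

definition mat_partial :: "'n \<Rightarrow> (complex^'n \<Rightarrow> complex^'n^'n) \<Rightarrow> complex^'n \<Rightarrow> complex^'n^'n" where
  "mat_partial a X p = (\<chi> i j. coord_partial u a (\<lambda>x. X x $ i $ j) p)"

definition euler :: "(complex^'n \<Rightarrow> complex) \<Rightarrow> complex^'n \<Rightarrow> complex" where
  "euler f p = (\<Sum>s\<in>UNIV. u p $ s * coord_partial u s f p)"

definition mat_euler :: "(complex^'n \<Rightarrow> complex^'n^'n) \<Rightarrow> complex^'n \<Rightarrow> complex^'n^'n" where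
  "mat_euler X p = (\<chi> i j. euler (\<lambda>x. X x $ i $ j) p)"

lemma holmat_nth: "holmat X \<Longrightarrow> hol (\<lambda>x. X x $ i $ j)"
  by (simp add: holomorphic_mat_on_def)

lemma holmat_const: "holmat (\<lambda>_. C)"
  by (simp add: holomorphic_mat_on_def holomorphic_fun_on_const open_domain)

lemma holmat_add: "holmat X \<Longrightarrow> holmat Y \<Longrightarrow> holmat (\<lambda>x. X x + Y x)"
  by (simp add: holomorphic_mat_on_def holomorphic_fun_on_add)

lemma holmat_diff: "holmat X \<Longrightarrow> holmat Y \<Longrightarrow> holmat (\<lambda>x. X x - Y x)"
  by (simp add: holomorphic_mat_on_def holomorphic_fun_on_diff)

lemma holmat_mult: "holmat X \<Longrightarrow> holmat Y \<Longrightarrow> holmat (\<lambda>x. X x ** Y x)"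
  by (simp add: holomorphic_mat_on_def matrix_mult_nth holomorphic_fun_on_sum holomorphic_fun_on_mult open_domain)

lemma holmat_commutator: "holmat X \<Longrightarrow> holmat Y \<Longrightarrow> holmat (\<lambda>x. commutator (X x) (Y x))"
  by (simp add: commutator_def holmat_diff holmat_mult)

lemma holmat_partial: "holmat X \<Longrightarrow> holmat (mat_partial a X)"
  by (simp add: holomorphic_mat_on_def mat_partial_def partial_hol(1))

lemma mat_partial_const: "mat_partial a (\<lambda>_. C) p = 0"
  by (simp add: mat_partial_def vec_eq_iff)

lemma mat_partial_cong:
  "p \<in> V \<Longrightarrow> (\<And>x. x \<in> V \<Longrightarrow> X x = Y x) \<Longrightarrow> mat_partial a X p = mat_partial a Y p"
  by (auto simp: mat_partial_def vec_eq_iff intro!: partial_cong)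

lemma mat_partial_add:
  "holmat X \<Longrightarrow> holmat Y \<Longrightarrow> p \<in> V \<Longrightarrow>
    mat_partial a (\<lambda>x. X x + Y x) p = mat_partial a X p + mat_partial a Y p"
  by (simp add: mat_partial_def vec_eq_iff partial_add holmat_nth)

lemma mat_partial_diff:
  "holmat X \<Longrightarrow> holmat Y \<Longrightarrow> p \<in> V \<Longrightarrow>
    mat_partial a (\<lambda>x. X x - Y x) p = mat_partial a X p - mat_partial a Y p"
  by (simp add: mat_partial_def vec_eq_iff partial_diff holmat_nth)

lemma mat_partial_mult:
  "holmat X \<Longrightarrow> holmat Y \<Longrightarrow> p \<in> V \<Longrightarrow>
    mat_partial a (\<lambda>x. X x ** Y x) p = mat_partial a X p ** Y p + X p ** mat_partial a Y p"
  by (simp add: mat_partial_def vec_eq_iff matrix_mult_nth partial_sum holomorphic_fun_on_mult holmat_nth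
      partial_mult sum.distrib)

lemma mat_partial_commute:
  "holmat X \<Longrightarrow> p \<in> V \<Longrightarrow>
    mat_partial b (mat_partial a X) p = mat_partial a (mat_partial b X) p"
  by (simp add: mat_partial_def vec_eq_iff partial_hol(2) holmat_nth)

lemma euler_mult:
  "hol f \<Longrightarrow> hol g \<Longrightarrow> p \<in> V \<Longrightarrow> euler (\<lambda>x. f x * g x) p = euler f p * g p + f p * euler g p"
  by (simp add: euler_def partial_mult algebra_simps sum.distrib sum_distrib_left)

lemma euler_add:
  "hol f \<Longrightarrow> hol g \<Longrightarrow> p \<in> V \<Longrightarrow> euler (\<lambda>x. f x + g x) p = euler f p + euler g p"
  by (simp add: euler_def partial_add algebra_simps sum.distrib)

lemma euler_sum:
  "(\<And>a. a \<in> A \<Longrightarrow> hol (f a)) \<Longrightarrow> p \<in> V \<Longrightarrow> euler (\<lambda>x. \<Sum>a\<in>A. f a x) p = (\<Sum>a\<in>A. euler (f a) p)"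
  by (simp add: euler_def partial_sum sum_distrib_left sum.swap[of _ UNIV])

lemma euler_cong:
  "p \<in> V \<Longrightarrow> (\<And>x. x \<in> V \<Longrightarrow> f x = g x) \<Longrightarrow> euler f p = euler g p"
  unfolding euler_def by (intro sum.cong refl arg_cong2[where f="(*)"] partial_cong) auto

lemma euler_const: "euler (\<lambda>_. c) p = 0"
  by (simp add: euler_def)

text \<open>
  This is \<open>[\<partial>\<^sub>a, E] = \<partial>\<^sub>a\<close> for \<open>E = \<Sum>\<^sub>s u\<^sup>s \<partial>\<^sub>s\<close>.
\<close>

lemma partial_euler:
  assumes "hol f" "p \<in> V"
  shows "coord_partial u a (euler f) p = euler (coord_partial u a f) p + coord_partial u a f p"
proof -
  have "coord_partial u a (euler f) p =
      (\<Sum>s\<in>UNIV. (if s = a then 1 else 0) * coord_partial u s f p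
        + u p $ s * coord_partial u a (coord_partial u s f) p)"
    unfolding euler_def using assms
    by (simp add: partial_sum partial_mult holomorphic_fun_on_mult coordinate_hol partial_hol(1) partial_coordinate
        )
  also have "\<dots> = euler (coord_partial u a f) p + coord_partial u a f p"
    using partial_hol(2)[OF assms, of a]
    by (simp add: euler_def sum.distrib if_distrib[of "\<lambda>x. x * _"] cong: if_cong)
  finally show ?thesis .
qed

lemma mat_euler_mult:
  "holmat X \<Longrightarrow> holmat Y \<Longrightarrow> p \<in> V \<Longrightarrow>
    mat_euler (\<lambda>x. X x ** Y x) p = mat_euler X p ** Y p + X p ** mat_euler Y p"
  by (simp add: mat_euler_def vec_eq_iff matrix_mult_nth euler_sum holomorphic_fun_on_mult holmat_nth
      euler_mult sum.distrib)

lemma mat_euler_cong: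
  "p \<in> V \<Longrightarrow> (\<And>x. x \<in> V \<Longrightarrow> X x = Y x) \<Longrightarrow> mat_euler X p = mat_euler Y p"
  by (auto simp: mat_euler_def vec_eq_iff intro!: euler_cong)

lemma mat_partial_euler:
  "holmat X \<Longrightarrow> p \<in> V \<Longrightarrow>
    mat_partial a (mat_euler X) p = mat_euler (mat_partial a X) p + mat_partial a X p"
  by (simp add: mat_partial_def mat_euler_def vec_eq_iff holmat_nth partial_euler)

text \<open>
  Mixed second derivatives of an invertible solution \<open>P\<close> of \<open>dP = A P\<close> agree, which is \<open>dA = A \<and> A\<close>.
\<close>

lemma flat_connection:
  assumes A: "\<And>a. holmat (A a)" and P: "holmat P" "\<And>x. x \<in> V \<Longrightarrow> invertible (P x)"
    and eq: "\<And>a x. x \<in> V \<Longrightarrow> mat_partial a P x = A a x ** P x" and p: "p \<in> V"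
  shows "mat_partial b (A a) p + A a p ** A b p = mat_partial a (A b) p + A b p ** A a p"
proof -
  have *: "mat_partial b (mat_partial a P) p = (mat_partial b (A a) p + A a p ** A b p) ** P p" for a b
  proof -
    have "mat_partial b (mat_partial a P) p = mat_partial b (\<lambda>x. A a x ** P x) p"
      by (rule mat_partial_cong[OF p eq])
    also have "\<dots> = (mat_partial b (A a) p + A a p ** A b p) ** P p"
      using A P(1) p by (simp add: mat_partial_mult eq matrix_ring_simps)
    finally show ?thesis .
  qed
  show ?thesis
    by (rule matrix_mult_right_cancel[OF P(2)[OF p]]) (metis * mat_partial_commute[OF P(1) p])
qed

text \<open>
  Apply \<open>[\<partial>\<^sub>a, E] = \<partial>\<^sub>a\<close> to \<open>P\<close>.  The terms with \<open>Q\<close> cancel, since \<open>Q\<close> acts from the other side than \<open>A\<close>.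
\<close>

lemma homogeneous_connection:
  assumes A: "\<And>a. holmat (A a)" and P: "holmat P" "\<And>x. x \<in> V \<Longrightarrow> invertible (P x)"
    and eq: "\<And>a x. x \<in> V \<Longrightarrow> mat_partial a P x = A a x ** P x"
    and hom: "\<And>x. x \<in> V \<Longrightarrow> mat_euler P x = C ** P x + P x ** Q" and p: "p \<in> V"
  shows "mat_euler (A a) p = commutator C (A a p) - A a p"
proof (rule matrix_mult_right_cancel[OF P(2)[OF p]])
  have "mat_partial a (mat_euler P) p = mat_partial a (\<lambda>x. C ** P x + P x ** Q) p"
    by (rule mat_partial_cong[OF p hom])
  also have "\<dots> = C ** A a p ** P p + A a p ** P p ** Q"
    using P(1) p by (simp add: mat_partial_add mat_partial_mult holmat_mult holmat_const mat_partial_const eq matrix_ring_simps)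
  finally have 1: "mat_partial a (mat_euler P) p = \<dots>" .
  have "mat_euler (mat_partial a P) p = mat_euler (\<lambda>x. A a x ** P x) p"
    by (rule mat_euler_cong[OF p eq])
  also have "\<dots> = mat_euler (A a) p ** P p + A a p ** C ** P p + A a p ** P p ** Q"
    using A P(1) p by (simp add: mat_euler_mult hom matrix_ring_simps)
  finally have 2: "mat_euler (mat_partial a P) p = \<dots>" .
  show "mat_euler (A a) p ** P p = (commutator C (A a p) - A a p) ** P p"
    using mat_partial_euler[OF P(1) p, of a] unfolding 1 2 eq[OF p]
    by (simp add: commutator_def matrix_ring_simps algebra_simps)
qed

lemma mat_d_coord_vf: "holmat X \<Longrightarrow> p \<in> V \<Longrightarrow> mat_d X p (coord_vf u a p) = mat_partial a X p"
  by (simp add: vec_eq_iff mat_d_def mat_partial_def frechet_derivative_mat coord_partial_def)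

lemma holmat_diag: "(\<And>i. hol (\<lambda>x. d x $ i)) \<Longrightarrow> holmat (\<lambda>x. diag_mat (d x))"
  unfolding holomorphic_mat_on_def
proof (intro allI)
  fix i j assume "\<And>i. hol (\<lambda>x. d x $ i)"
  then show "hol (\<lambda>x. diag_mat (d x) $ i $ j)"
    by (cases "i = j") (simp_all add: diag_mat_def holomorphic_fun_on_const open_domain)
qed

lemma mat_d_diag_nth:
  fixes d :: "complex^'n \<Rightarrow> complex^'n"
  assumes "\<And>i. hol (\<lambda>x. d x $ i)" "p \<in> V"
  shows "mat_d (\<lambda>x. diag_mat (d x)) p v = diag_mat (\<chi> i. frechet_derivative (\<lambda>x. d x $ i) (at p) v)"
  unfolding vec_eq_iff mat_d_def frechet_derivative_mat[OF holmat_diag[of d, OF assms(1)] assms(2)]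
  by (simp add: diag_mat_def)

lemma mat_d_diag_coordinates:
  assumes "p \<in> V"
  shows "mat_d (\<lambda>x. diag_mat (u x)) p v = diag_mat (frechet_derivative u (at p) v)"
proof -
  have "(\<chi> i. frechet_derivative (\<lambda>x. u x $ i) (at p) v) = frechet_derivative u (at p) v"
    using frechet_derivative_vec(2)[of u V p v] coordinates assms
    by (simp add: vec_eq_iff coordinates_on_def)
  then show ?thesis using mat_d_diag_nth[of u, OF coordinate_hol assms] by simp
qed

end

section \<open>The recursion for the R-matrices\<close>

locale rotation_matrix = holomorphic_chart V u
  for V :: "(complex^'n::finite) set" and u :: "complex^'n \<Rightarrow> complex^'n" +
  fixes G :: "complex^'n \<Rightarrow> complex^'n^'n"
  assumes G_hol: "holomorphic_mat_on G V"
    and G_diag: "\<And>p i. p \<in> V \<Longrightarrow> G p $ i $ i = 0"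
begin

text \<open>
  \<open>conn a\<close>, \<open>cov X a\<close> and \<open>diag_form Y i a\<close> are the values on \<open>\<partial>\<^sub>a\<close> of the matrix one-forms \<open>[\<Gamma>, dU]\<close> and
  \<open>dX + X [\<Gamma>, dU]\<close>, and of the diagonal entry \<open>i\<close> of \<open>Y [\<Gamma>, dU]\<close>.
\<close>

definition conn :: "'n \<Rightarrow> complex^'n \<Rightarrow> complex^'n^'n" where
  "conn a p = commutator (G p) (coord_proj a)"

definition cov :: "(complex^'n \<Rightarrow> complex^'n^'n) \<Rightarrow> 'n \<Rightarrow> complex^'n \<Rightarrow> complex^'n^'n" where
  "cov X a p = mat_partial a X p + X p ** conn a p"

text \<open>
  \<open>N i j\<close> is the entry \<open>(i,j)\<close> of \<open>cov X j\<close> (\<open>cov_last_nth\<close>), which for \<open>i \<noteq> j\<close> the differential equation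
  forces on the next matrix.  The diagonal comes from the following equation, contracted with the
  Euler field.
\<close>

definition next_coeff :: "nat \<Rightarrow> (complex^'n \<Rightarrow> complex^'n^'n) \<Rightarrow> complex^'n \<Rightarrow> complex^'n^'n" where
  "next_coeff k X p =
     (let N = (\<lambda>i j. coord_partial u j (\<lambda>x. X x $ i $ j) p + (X p ** G p) $ i $ j)
      in \<chi> i j. if i = j then (\<Sum>l\<in>UNIV. N i l * G p $ l $ i * (u p $ i - u p $ l)) / of_nat (Suc k)
                else N i j)"

lemma conn_nth: "conn a p $ i $ j = G p $ i $ j * (axis a 1 $ j - axis a 1 $ i)"
  by (simp add: conn_def commutator_diag_nth)

lemma mult_conn_nth:
  "(X ** conn a p) $ i $ j = (\<Sum>l\<in>UNIV. X $ i $ l * G p $ l $ j * (axis a 1 $ j - axis a 1 $ l))"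
  by (simp add: matrix_mult_nth conn_nth mult.assoc)

lemma holmat_conn: "holmat (conn a)"
  unfolding conn_def[abs_def] by (intro holmat_commutator G_hol holmat_const)

lemma holmat_cov: "holmat X \<Longrightarrow> holmat (cov X a)"
  unfolding cov_def[abs_def] by (intro holmat_add holmat_mult holmat_conn holmat_partial)

lemma cov_last_nth:
  assumes "p \<in> V"
  shows "cov X j p $ i $ j = coord_partial u j (\<lambda>x. X x $ i $ j) p + (X p ** G p) $ i $ j"
proof -
  have "(X p ** conn j p) $ i $ j = (X p ** G p) $ i $ j"
    unfolding mult_conn_nth unfolding matrix_mult_nth
    by (rule sum.cong) (use G_diag[OF assms] in \<open>auto simp: axis_def\<close>)
  then show ?thesis by (simp add: cov_def mat_partial_def)
qed

lemma next_coeff_offdiag: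
  "p \<in> V \<Longrightarrow> i \<noteq> j \<Longrightarrow> next_coeff k X p $ i $ j = cov X j p $ i $ j"
  by (simp add: next_coeff_def cov_last_nth)

text \<open>
  The unknown matrix may stand on both sides because the summand \<open>l = i\<close> is zero.
\<close>

lemma next_coeff_diag:
  assumes "p \<in> V"
  shows "of_nat (Suc k) * next_coeff k X p $ i $ i =
    (\<Sum>l\<in>UNIV. next_coeff k X p $ i $ l * G p $ l $ i * (u p $ i - u p $ l))"
proof -
  have "of_nat (Suc k) * next_coeff k X p $ i $ i =
    (\<Sum>l\<in>UNIV. cov X l p $ i $ l * G p $ l $ i * (u p $ i - u p $ l))"
    using assms by (simp add: next_coeff_def cov_last_nth del: of_nat_Suc)
  also have "\<dots> = (\<Sum>l\<in>UNIV. next_coeff k X p $ i $ l * G p $ l $ i * (u p $ i - u p $ l))"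
  proof (rule sum.cong)
    fix l show "cov X l p $ i $ l * G p $ l $ i * (u p $ i - u p $ l) =
       next_coeff k X p $ i $ l * G p $ l $ i * (u p $ i - u p $ l)"
      by (cases "l = i") (simp_all add: next_coeff_offdiag[OF assms])
  qed simp
  finally show ?thesis .
qed

lemma next_coeffI:
  assumes p: "p \<in> V" and off: "\<And>i j. i \<noteq> j \<Longrightarrow> Y $ i $ j = cov X j p $ i $ j"
    and diag: "\<And>i. of_nat (Suc k) * Y $ i $ i = (\<Sum>l\<in>UNIV. Y $ i $ l * G p $ l $ i * (u p $ i - u p $ l))"
  shows "Y = next_coeff k X p"
proof -
  have *: "Y $ i $ j = next_coeff k X p $ i $ j" if "i \<noteq> j" for i j
    using that off next_coeff_offdiag[OF p] by simp
  have "Y $ i $ i = next_coeff k X p $ i $ i" for i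
  proof -
    have "(\<Sum>l\<in>UNIV. Y $ i $ l * G p $ l $ i * (u p $ i - u p $ l)) =
        (\<Sum>l\<in>UNIV. next_coeff k X p $ i $ l * G p $ l $ i * (u p $ i - u p $ l))"
    proof (rule sum.cong)
      fix l show "Y $ i $ l * G p $ l $ i * (u p $ i - u p $ l) =
          next_coeff k X p $ i $ l * G p $ l $ i * (u p $ i - u p $ l)"
        by (cases "l = i") (simp_all add: *)
    qed simp
    then have "of_nat (Suc k) * Y $ i $ i = of_nat (Suc k) * next_coeff k X p $ i $ i"
      using diag next_coeff_diag[OF p] by simp
    then show ?thesis using of_nat_neq_0 mult_left_cancel by blast
  qed
  then have "Y $ i $ j = next_coeff k X p $ i $ j" for i j
    by (cases "i = j") (use * in auto)
  then show ?thesis by (simp add: vec_eq_iff)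
qed

lemma holmat_next_coeff:
  assumes "holmat X" shows "holmat (next_coeff k X)"
  unfolding holomorphic_mat_on_def
proof (intro allI)
  fix i j
  have off: "hol (\<lambda>p. cov X j p $ i $ j)" for i j
    by (rule holmat_nth[OF holmat_cov[OF assms]])
  show "hol (\<lambda>p. next_coeff k X p $ i $ j)"
  proof (cases "i = j")
    case True
    have "hol (\<lambda>p. (1 / of_nat (Suc k)) *
        (\<Sum>l\<in>UNIV. cov X l p $ i $ l * G p $ l $ i * (u p $ i - u p $ l)))"
      by (intro holomorphic_fun_on_mult holomorphic_fun_on_const holomorphic_fun_on_sum holomorphic_fun_on_diff
          off open_domain coordinate_hol holmat_nth[OF G_hol]) auto
    then show ?thesis
      using True by (simp add: next_coeff_def cov_last_nth cong: holomorphic_fun_on_cong)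
  next
    case False
    then show ?thesis
      using off[of j i] by (simp add: next_coeff_offdiag cong: holomorphic_fun_on_cong)
  qed
qed

definition diag_form :: "(complex^'n \<Rightarrow> complex^'n^'n) \<Rightarrow> 'n \<Rightarrow> 'n \<Rightarrow> complex^'n \<Rightarrow> complex" where
  "diag_form Y i a p = (Y p ** conn a p) $ i $ i"

lemma sum_axis_diff:
  fixes c :: "complex^'n"
  shows "(\<Sum>a\<in>UNIV. c $ a * (z * (axis a 1 $ j - axis a 1 $ i))) = z * (c $ j - c $ i)"
proof -
  have "(\<Sum>a\<in>UNIV. c $ a * (axis a 1 $ j - axis a 1 $ i)) = c $ j - c $ i"
    by (simp add: axis_def right_diff_distrib sum_subtractf if_distrib[of "\<lambda>x. _ * x"] cong: if_cong)
  then show ?thesis by (simp add: mult.left_commute[of _ z] flip: sum_distrib_left)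
qed

lemma diag_form_contract:
  "(\<Sum>a\<in>UNIV. u p $ a * diag_form Y i a p) = (\<Sum>l\<in>UNIV. Y p $ i $ l * G p $ l $ i * (u p $ i - u p $ l))"
proof -
  have "(\<Sum>a\<in>UNIV. u p $ a * diag_form Y i a p) =
     (\<Sum>l\<in>UNIV. \<Sum>a\<in>UNIV. u p $ a * (Y p $ i $ l * G p $ l $ i * (axis a 1 $ i - axis a 1 $ l)))"
    unfolding diag_form_def mult_conn_nth sum_distrib_left by (rule sum.swap)
  also have "\<dots> = (\<Sum>l\<in>UNIV. Y p $ i $ l * G p $ l $ i * (u p $ i - u p $ l))"
    by (simp only: sum_axis_diff)
  finally show ?thesis .
qed


text \<open>
  Both sides are linear in \<open>v\<close>, so the coordinate frame suffices; \<open>dU\<close> takes the value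
  \<open>coord_proj a\<close> on \<open>\<partial>\<^sub>a\<close>.
\<close>

lemma frame_equation_iff:
  assumes X: "holmat X" and p: "p \<in> V"
  shows "(\<forall>v. mat_d X p v + X p ** commutator (G p) (mat_d (\<lambda>x. diag_mat (u x)) p v)
             = commutator Y (mat_d (\<lambda>x. diag_mat (u x)) p v))
         \<longleftrightarrow> (\<forall>a. cov X a p = commutator Y (coord_proj a))" (is "?L \<longleftrightarrow> ?R")
proof
  assume L: ?L
  show ?R
  proof
    fix a
    show "cov X a p = commutator Y (coord_proj a)"
      using L[rule_format, of "coord_vf u a p"] p X
      by (simp add: mat_d_coord_vf mat_d_diag_coordinates differential_coord_vf cov_def conn_def)
  qed
next
  assume R: ?R
  show ?L
  proof
    fix v
    let ?c = "frechet_derivative u (at p) v"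
    have c: "?c $ a = frechet_derivative (\<lambda>x. u x $ a) (at p) v" for a
      using frechet_derivative_vec(2) coordinates p by (auto simp: coordinates_on_def)
    have "mat_d X p v $ i $ j + (X p ** commutator (G p) (diag_mat ?c)) $ i $ j
        = commutator Y (diag_mat ?c) $ i $ j" for i j
    proof -
      have "mat_d X p v $ i $ j = (\<Sum>a\<in>UNIV. ?c $ a * mat_partial a X p $ i $ j)"
        using differential_expansion[OF holmat_nth[OF X] p, of i j v]
        by (simp add: mat_d_def frechet_derivative_mat[OF X p] mat_partial_def c)
      moreover have "(X p ** commutator (G p) (diag_mat ?c)) $ i $ j = (\<Sum>a\<in>UNIV. ?c $ a * (X p ** conn a p) $ i $ j)"
      proof -
        have "(\<Sum>a\<in>UNIV. ?c $ a * (X p ** conn a p) $ i $ j) =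
          (\<Sum>l\<in>UNIV. \<Sum>a\<in>UNIV. ?c $ a * (X p $ i $ l * G p $ l $ j * (axis a 1 $ j - axis a 1 $ l)))"
          unfolding mult_conn_nth sum_distrib_left by (rule sum.swap)
        also have "\<dots> = (\<Sum>l\<in>UNIV. X p $ i $ l * G p $ l $ j * (?c $ j - ?c $ l))"
          by (simp only: sum_axis_diff)
        finally show ?thesis by (simp add: matrix_mult_nth commutator_diag_nth mult.assoc)
      qed
      moreover have "commutator Y (diag_mat ?c) $ i $ j = (\<Sum>a\<in>UNIV. ?c $ a * commutator Y (coord_proj a) $ i $ j)"
        by (simp only: commutator_diag_nth sum_axis_diff)
      moreover have "mat_partial a X p $ i $ j + (X p ** conn a p) $ i $ j = commutator Y (coord_proj a) $ i $ j" for a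
        using R by (metis cov_def vector_add_component)
      ultimately show ?thesis
        by (simp flip: sum.distrib distrib_left)
    qed
    then show "mat_d X p v + X p ** commutator (G p) (mat_d (\<lambda>x. diag_mat (u x)) p v)
             = commutator Y (mat_d (\<lambda>x. diag_mat (u x)) p v)"
      by (simp add: vec_eq_iff mat_d_diag_coordinates[OF p])
  qed
qed

text \<open>
  Uniqueness: off the diagonal, read the equation between \<open>R k\<close> and \<open>R (Suc k)\<close>; on the diagonal,
  the one between \<open>R (Suc k)\<close> and \<open>R (Suc (Suc k))\<close>, whose right-hand side has zero diagonal there.
\<close>

lemma R_matrices_recursion:
  assumes R: "homogeneous_R_matrices V u G \<delta> R" and p: "p \<in> V"
  shows "R (Suc k) p = next_coeff k (R k) p"
proof (rule next_coeffI[OF p])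
  have hol: "holmat (R k)" for k
    using R by (simp add: homogeneous_R_matrices_def)
  have cov: "cov (R k) a p = commutator (R (Suc k) p) (coord_proj a)" for k a
  proof -
    have "\<forall>v. mat_d (R k) p v + R k p ** commutator (G p) (mat_d (\<lambda>x. diag_mat (u x)) p v)
             = commutator (R (Suc k) p) (mat_d (\<lambda>x. diag_mat (u x)) p v)"
      using R[unfolded homogeneous_R_matrices_def, THEN conjunct2, THEN conjunct2, THEN conjunct1,
          rule_format, of "Suc k" p] p by simp
    then show ?thesis using frame_equation_iff[OF hol p] by blast
  qed
  show "R (Suc k) p $ i $ j = cov (R k) j p $ i $ j" if "i \<noteq> j" for i j
    using that by (simp add: cov commutator_diag_nth axis_def)
  show "of_nat (Suc k) * R (Suc k) p $ i $ i =
      (\<Sum>l\<in>UNIV. R (Suc k) p $ i $ l * G p $ l $ i * (u p $ i - u p $ l))" for i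
  proof -
    have "coord_partial u a (\<lambda>x. R (Suc k) x $ i $ i) p = - diag_form (R (Suc k)) i a p" for a
    proof -
      have "cov (R (Suc k)) a p $ i $ i = 0" by (simp add: cov commutator_diag_nth)
      then show ?thesis by (simp add: cov_def mat_partial_def diag_form_def eq_neg_iff_add_eq_0)
    qed
    then have "euler (\<lambda>x. R (Suc k) x $ i $ i) p =
        - (\<Sum>l\<in>UNIV. R (Suc k) p $ i $ l * G p $ l $ i * (u p $ i - u p $ l))"
      by (simp add: euler_def sum_negf flip: diag_form_contract)
    moreover have "euler (\<lambda>x. R (Suc k) x $ i $ i) p = - (of_nat (Suc k) * R (Suc k) p $ i $ i)"
      using R p by (simp add: homogeneous_R_matrices_def euler_def del: of_nat_Suc)
    ultimately show ?thesis by (simp only: neg_equal_iff_equal)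
  qed
qed

end

section \<open>Existence of homogeneous R-matrices\<close>

text \<open>
  The two assumptions are \<open>dA = A \<and> A\<close> for \<open>A = [\<Gamma>, dU]\<close>, and the degree of the rotation coefficients.
\<close>

locale homogeneous_rotation_matrix = rotation_matrix V u G
  for V :: "(complex^'n::finite) set" and u :: "complex^'n \<Rightarrow> complex^'n"
    and G :: "complex^'n \<Rightarrow> complex^'n^'n" +
  fixes \<delta> :: "complex^'n"
  assumes flat: "\<And>p a b. p \<in> V \<Longrightarrow>
      mat_partial b (conn a) p + conn a p ** conn b p = mat_partial a (conn b) p + conn b p ** conn a p"
    and G_euler: "\<And>p i j. p \<in> V \<Longrightarrow> euler (\<lambda>x. G x $ i $ j) p = (\<delta> $ i - \<delta> $ j - 1) * G p $ i $ j"
begin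

text \<open>
  With \<open>\<omega> = dY + Y A\<close>, the exterior derivative of \<open>dX + X A = [Y, dU]\<close> becomes \<open>\<omega> \<and> dU + dU \<and> \<omega> = 0\<close>,
  because flatness removes all terms with \<open>X\<close> and \<open>dU \<and> dU = 0\<close> all those with \<open>Y\<close>.
\<close>

lemma cov_curl:
  assumes X: "holmat X" and Y: "holmat Y" and p: "p \<in> V"
    and XY: "\<And>a x. x \<in> V \<Longrightarrow> cov X a x = commutator (Y x) (coord_proj a)"
  shows "commutator (cov Y a p) (coord_proj b) = commutator (cov Y b p) (coord_proj a)"
proof -
  let ?E = "coord_proj :: 'n \<Rightarrow> complex^'n^'n"
  have dX: "mat_partial b X p = commutator (Y p) (?E b) - X p ** conn b p" for b
    using XY[OF p, of b] by (simp add: cov_def algebra_simps)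
  have dY: "mat_partial b Y p = cov Y b p - Y p ** conn b p" for b
    by (simp add: cov_def)
  \<comment> \<open>The derivative along \<open>\<partial>\<^sub>b\<close> of the hypothesis for \<open>\<partial>\<^sub>a\<close>; its antisymmetric part is the claim.\<close>
  have key: "commutator (cov Y b p - Y p ** conn b p) (?E a) =
      mat_partial b (mat_partial a X) p + (commutator (Y p) (?E b) - X p ** conn b p) ** conn a p
        + X p ** mat_partial b (conn a) p" for a b
  proof -
    have "mat_partial b (cov X a) p = mat_partial b (\<lambda>x. commutator (Y x) (?E a)) p"
      by (rule mat_partial_cong[OF p XY])
    then show ?thesis
      using X Y p unfolding cov_def[of X, abs_def] commutator_def[of "Y _" "?E a"]
      by (simp add: mat_partial_add mat_partial_diff mat_partial_mult holmat_partial holmat_mult holmat_const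
          holmat_conn mat_partial_const dX dY) (simp add: commutator_def algebra_simps)
  qed
  have fl: "mat_partial b (conn a) p = mat_partial a (conn b) p + conn b p ** conn a p - conn a p ** conn b p"
    using flat[OF p, of b a] by (simp add: algebra_simps)
  have E: "Z ** ?E a ** ?E b = Z ** ?E b ** ?E a" for Z
    using diag_mat_commute by (metis matrix_mul_assoc)
  have "commutator (cov Y b p) (?E a) - commutator (cov Y a p) (?E b)
     = commutator (cov Y b p - Y p ** conn b p) (?E a) - commutator (cov Y a p - Y p ** conn a p) (?E b)
       + commutator (Y p ** conn b p) (?E a) - commutator (Y p ** conn a p) (?E b)"
    by (simp add: commutator_def matrix_ring_simps)
  also have "\<dots> = 0"
    unfolding key mat_partial_commute[OF X p, of a b] fl
    by (simp add: commutator_def conn_def matrix_ring_simps E diag_mat_commute[of "axis a 1" "axis b 1"] algebra_simps)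
  finally show ?thesis by simp
qed

text \<open>
  A one-form whose wedge product with \<open>du\<^sup>j - du\<^sup>i\<close> vanishes is a multiple of it.
\<close>

lemma offdiag_of_curl:
  assumes "commutator (cov Y a p) (coord_proj j) = commutator (cov Y j p) (coord_proj a)" "i \<noteq> j"
  shows "cov Y a p $ i $ j = cov Y j p $ i $ j * (axis a 1 $ j - axis a 1 $ i)"
proof -
  have "commutator (cov Y a p) (coord_proj j) $ i $ j = commutator (cov Y j p) (coord_proj a) $ i $ j"
    using assms(1) by simp
  then show ?thesis using assms(2) by (simp add: commutator_diag_nth axis_def)
qed

text \<open>
  By flatness \<open>d(Y A) = (dY + Y A) \<and> A\<close>.  On the diagonal each summand is a product of a multiple of
  \<open>du\<^sup>l - du\<^sup>i\<close> with one of \<open>du\<^sup>i - du\<^sup>l\<close>, hence zero.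
\<close>

lemma diag_form_closed:
  assumes Y: "holmat Y" and p: "p \<in> V"
    and off: "\<And>a i j. i \<noteq> j \<Longrightarrow> cov Y a p $ i $ j = cov Y j p $ i $ j * (axis a 1 $ j - axis a 1 $ i)"
  shows "coord_partial u b (diag_form Y i a) p = coord_partial u a (diag_form Y i b) p"
proof -
  have d: "mat_partial b (\<lambda>x. Y x ** conn a x) p =
      cov Y b p ** conn a p - Y p ** conn b p ** conn a p + Y p ** mat_partial b (conn a) p" for a b
    using Y p by (simp add: mat_partial_mult holmat_conn cov_def matrix_ring_simps)
  have fl: "Y p ** mat_partial b (conn a) p = 
      Y p ** mat_partial a (conn b) p + Y p ** conn b p ** conn a p - Y p ** conn a p ** conn b p"
    using arg_cong[OF flat[OF p, of b a], of "\<lambda>Z. Y p ** Z"] by (simp add: matrix_ring_simps algebra_simps)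
  have "(cov Y b p ** conn a p) $ i $ i = (cov Y a p ** conn b p) $ i $ i"
    unfolding mult_conn_nth
  proof (rule sum.cong)
    fix l
    show "cov Y b p $ i $ l * G p $ l $ i * (axis a 1 $ i - axis a 1 $ l) =
        cov Y a p $ i $ l * G p $ l $ i * (axis b 1 $ i - axis b 1 $ l)"
      by (cases "i = l") (simp_all add: off[of i l a] off[of i l b] algebra_simps)
  qed simp
  then have "mat_partial b (\<lambda>x. Y x ** conn a x) p $ i $ i = mat_partial a (\<lambda>x. Y x ** conn b x) p $ i $ i"
    unfolding d by (simp add: fl)
  then show ?thesis by (simp add: mat_partial_def diag_form_def[abs_def])
qed

text \<open>
  The degree of the components on \<open>\<partial>\<^sub>a\<close> is one less than the degree \<open>- m\<close> of the one-form, because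
  each \<open>du\<^sup>a\<close> has degree one.
\<close>

lemma euler_diag_form:
  assumes Y: "holmat Y" and p: "p \<in> V"
    and hom: "\<And>i j x. x \<in> V \<Longrightarrow> i \<noteq> j \<Longrightarrow> euler (\<lambda>x. Y x $ i $ j) x = (\<delta> $ i - \<delta> $ j - m) * Y x $ i $ j"
  shows "euler (diag_form Y i a) p = - (m + 1) * diag_form Y i a p"
proof -
  have h: "hol (\<lambda>x. Y x $ i $ l * G x $ l $ i)" for l
    by (intro holomorphic_fun_on_mult holmat_nth Y G_hol)
  have "euler (\<lambda>x. Y x $ i $ l * G x $ l $ i * (axis a 1 $ i - axis a 1 $ l)) p
      = - (m + 1) * (Y p $ i $ l * G p $ l $ i * (axis a 1 $ i - axis a 1 $ l))" for l
  proof (cases "l = i")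
    case False
    then have "euler (\<lambda>x. Y x $ i $ l * G x $ l $ i) p = - (m + 1) * (Y p $ i $ l * G p $ l $ i)"
      using p by (simp add: euler_mult holmat_nth Y G_hol hom G_euler algebra_simps)
    then show ?thesis
      using euler_mult[OF h holomorphic_fun_on_const[OF open_domain] p, of l] by (simp add: euler_const)
  qed (simp add: euler_const)
  moreover have "hol (\<lambda>x. Y x $ i $ l * G x $ l $ i * (axis a 1 $ i - axis a 1 $ l))" for l
    by (intro h holomorphic_fun_on_mult holomorphic_fun_on_const open_domain)
  ultimately show ?thesis
    unfolding diag_form_def mult_conn_nth using p by (simp add: euler_sum sum_distrib_left)
qed

lemma euler_next_coeff_offdiag:
  assumes X: "holmat X" and p: "p \<in> V" and ij: "i \<noteq> j"
    and hom: "\<And>i j x. x \<in> V \<Longrightarrow> euler (\<lambda>x. X x $ i $ j) x = (\<delta> $ i - \<delta> $ j - m) * X x $ i $ j"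
  shows "euler (\<lambda>x. next_coeff k X x $ i $ j) p = (\<delta> $ i - \<delta> $ j - (m + 1)) * next_coeff k X p $ i $ j"
proof -
  have "euler (\<lambda>x. next_coeff k X x $ i $ j) p =
      euler (\<lambda>x. coord_partial u j (\<lambda>x. X x $ i $ j) x + (\<Sum>l\<in>UNIV. X x $ i $ l * G x $ l $ j)) p"
    by (rule euler_cong[OF p]) (use ij in \<open>simp add: next_coeff_def matrix_mult_nth\<close>)
  also have "\<dots> = euler (coord_partial u j (\<lambda>x. X x $ i $ j)) p + (\<Sum>l\<in>UNIV. euler (\<lambda>x. X x $ i $ l * G x $ l $ j) p)"
    using p by (simp add: euler_add euler_sum partial_hol(1) holmat_nth X G_hol holomorphic_fun_on_mult
        holomorphic_fun_on_sum open_domain)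
  also have "euler (coord_partial u j (\<lambda>x. X x $ i $ j)) p
      = (\<delta> $ i - \<delta> $ j - (m + 1)) * coord_partial u j (\<lambda>x. X x $ i $ j) p"
  proof -
    have "coord_partial u j (euler (\<lambda>x. X x $ i $ j)) p = coord_partial u j (\<lambda>x. (\<delta> $ i - \<delta> $ j - m) * X x $ i $ j) p"
      by (rule partial_cong[OF p hom])
    then show ?thesis
      unfolding partial_euler[OF holmat_nth[OF X] p] partial_cmult[OF holmat_nth[OF X] p]
      by (simp add: algebra_simps)
  qed
  also have "(\<Sum>l\<in>UNIV. euler (\<lambda>x. X x $ i $ l * G x $ l $ j) p)
      = (\<delta> $ i - \<delta> $ j - (m + 1)) * (X p ** G p) $ i $ j"
    unfolding matrix_mult_nth sum_distrib_left
    using p by (intro sum.cong refl) (simp add: euler_mult holmat_nth X G_hol hom G_euler algebra_simps)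
  finally show ?thesis using ij by (simp add: next_coeff_def algebra_simps)
qed

text \<open>
  Cartan's formula.  For \<open>\<sigma> = diag_form (next_coeff k X) i\<close> the function \<open>\<sigma>(E)\<close> is \<open>Suc k\<close> times the diagonal
  entry.  As \<open>\<sigma>\<close> is closed, \<open>d(\<sigma>(E))\<close> is the Lie derivative of \<open>\<sigma>\<close> along \<open>E\<close>, which equals \<open>- Suc k\<close>
  times \<open>\<sigma>\<close> by homogeneity.
\<close>

lemma next_coeff_step:
  assumes X: "holmat X" 
    and hom: "\<And>i j x. x \<in> V \<Longrightarrow> euler (\<lambda>x. X x $ i $ j) x = (\<delta> $ i - \<delta> $ j - of_nat k) * X x $ i $ j"
    and XY: "\<And>a x. x \<in> V \<Longrightarrow> cov X a x = commutator (next_coeff k X x) (coord_proj a)"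
    and p: "p \<in> V"
  shows "cov (next_coeff k X) a p $ i $ i = 0" 
    and "euler (\<lambda>x. next_coeff k X x $ i $ i) p = - of_nat (Suc k) * next_coeff k X p $ i $ i"
proof -
  let ?Y = "next_coeff k X" and ?n = "of_nat (Suc k) :: complex"
  have Y: "holmat ?Y" by (rule holmat_next_coeff[OF X])
  have n: "?n = of_nat k + 1" "?n \<noteq> 0" by (simp_all del: of_nat_Suc) simp
  have hs: "hol (diag_form ?Y i a)" for a
    unfolding diag_form_def[abs_def] by (intro holmat_nth holmat_mult Y holmat_conn)
  have hy: "hol (\<lambda>x. ?Y x $ i $ i)" by (rule holmat_nth[OF Y])
  have eul: "euler (diag_form ?Y i b) p = - (?n + 1) * diag_form ?Y i b p" for b
    using euler_diag_form[OF Y p, of ?n] euler_next_coeff_offdiag[OF X _ _ hom, of _ _ _ k] n by simp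
  have closed: "coord_partial u b (diag_form ?Y i a) p = coord_partial u a (diag_form ?Y i b) p" for a b
    by (rule diag_form_closed[OF Y p offdiag_of_curl[OF cov_curl[OF X Y p XY]]])
  have diag: "?n * ?Y x $ i $ i = (\<Sum>a\<in>UNIV. u x $ a * diag_form ?Y i a x)" if "x \<in> V" for x
    using next_coeff_diag[OF that] by (simp only: diag_form_contract)
  \<comment> \<open>The components of \<open>d(\<sigma>(E))\<close>: closedness turns \<open>\<Sum>\<^sub>a u\<^sup>a \<partial>\<^sub>b \<sigma>\<^sub>a\<close> into
      \<open>E \<sigma>\<^sub>b\<close>, which has degree \<open>- (Suc k + 1)\<close>.\<close>
  have "?n * coord_partial u b (\<lambda>x. ?Y x $ i $ i) p = - ?n * diag_form ?Y i b p" for b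
  proof -
    have "?n * coord_partial u b (\<lambda>x. ?Y x $ i $ i) p = coord_partial u b (\<lambda>x. ?n * ?Y x $ i $ i) p"
      using partial_cmult[OF hy p] by simp
    also have "\<dots> = coord_partial u b (\<lambda>x. \<Sum>a\<in>UNIV. u x $ a * diag_form ?Y i a x) p"
      by (rule partial_cong[OF p diag])
    also have "\<dots> = (\<Sum>a\<in>UNIV. (if a = b then 1 else 0) * diag_form ?Y i a p
          + u p $ a * coord_partial u b (diag_form ?Y i a) p)"
      using p hs by (simp add: partial_sum partial_mult holomorphic_fun_on_mult coordinate_hol partial_coordinate)
    also have "\<dots> = diag_form ?Y i b p + euler (diag_form ?Y i b) p"
      by (simp add: euler_def sum.distrib closed[of b] if_distrib[of "\<lambda>x. x * _"] cong: if_cong)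
    finally show ?thesis by (simp add: eul algebra_simps)
  qed
  then have d: "coord_partial u b (\<lambda>x. ?Y x $ i $ i) p = - diag_form ?Y i b p" for b
    using n(2) by (metis mult_left_cancel mult_minus_left mult_minus_right)
  then show "cov ?Y a p $ i $ i = 0"
    by (simp add: cov_def mat_partial_def diag_form_def)
  show "euler (\<lambda>x. ?Y x $ i $ i) p = - ?n * ?Y p $ i $ i"
    using diag[OF p] by (simp add: euler_def d sum_negf del: of_nat_Suc)
qed

primrec R_coeff :: "nat \<Rightarrow> complex^'n \<Rightarrow> complex^'n^'n" where
  "R_coeff 0 = (\<lambda>p. mat 1)"
| "R_coeff (Suc k) = next_coeff k (R_coeff k)"

lemma R_coeff_properties:
  "holmat (R_coeff k)
   \<and> (\<forall>i j. \<forall>p\<in>V. euler (\<lambda>x. R_coeff k x $ i $ j) p = (\<delta> $ i - \<delta> $ j - of_nat k) * R_coeff k p $ i $ j)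
   \<and> (\<forall>a. \<forall>p\<in>V. cov (R_coeff k) a p = commutator (R_coeff (Suc k) p) (coord_proj a))"
proof (induction k)
  case 0
  have "cov (R_coeff 0) a p $ i $ j = commutator (R_coeff (Suc 0) p) (coord_proj a) $ i $ j" if "p \<in> V" for a p i j
    using that G_diag[OF that, of i]
    by (cases "i = j") (simp_all add: commutator_diag_nth next_coeff_offdiag cov_def mat_partial_const conn_nth axis_def)
  moreover have "(\<delta> $ i - \<delta> $ j) * (mat 1 :: complex^'n^'n) $ i $ j = 0" for i j
    by (simp add: mat_def)
  ultimately show ?case
    by (auto simp: vec_eq_iff holmat_const euler_const)
next
  case (Suc k)
  let ?X = "R_coeff k" and ?Y = "R_coeff (Suc k)"
  have X: "holmat ?X" 
    and hom: "\<And>i j x. x \<in> V \<Longrightarrow> euler (\<lambda>x. ?X x $ i $ j) x = (\<delta> $ i - \<delta> $ j - of_nat k) * ?X x $ i $ j"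
    and XY: "\<And>a x. x \<in> V \<Longrightarrow> cov ?X a x = commutator (next_coeff k ?X x) (coord_proj a)"
    using Suc by auto
  have Y: "holmat ?Y" using holmat_next_coeff[OF X] by simp
  have "euler (\<lambda>x. ?Y x $ i $ j) p = (\<delta> $ i - \<delta> $ j - of_nat (Suc k)) * ?Y p $ i $ j" if p: "p \<in> V" for i j p
  proof (cases "i = j")
    case True
    then show ?thesis using next_coeff_step(2)[OF X hom XY p] by simp
  next
    case False
    then show ?thesis using euler_next_coeff_offdiag[OF X p False hom, of k] by (simp add: add.commute)
  qed
  moreover have "cov ?Y a p $ i $ j = commutator (R_coeff (Suc (Suc k)) p) (coord_proj a) $ i $ j" if p: "p \<in> V" for i j a p
  proof (cases "i = j")
    case True
    then show ?thesis using next_coeff_step(1)[OF X hom XY p] by (simp add: commutator_diag_nth)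
  next
    case False
    have "cov ?Y a p $ i $ j = cov ?Y j p $ i $ j * (axis a 1 $ j - axis a 1 $ i)"
      by (rule offdiag_of_curl[OF cov_curl[OF X Y p] False]) (simp add: XY)
    then show ?thesis
      using False p by (simp add: commutator_diag_nth next_coeff_offdiag)
  qed
  ultimately show ?case using Y by (auto simp: vec_eq_iff)
qed

lemma homogeneous_R_matrices_R_coeff: "homogeneous_R_matrices V u G \<delta> R_coeff"
  unfolding homogeneous_R_matrices_def
proof (intro conjI allI impI ballI)
  fix k p v assume "1 \<le> (k::nat)" and p: "p \<in> V"
  then have "\<forall>a. cov (R_coeff (k - 1)) a p = commutator (R_coeff k p) (coord_proj a)"
    using R_coeff_properties[of "k - 1"] by simp
  then show "mat_d (R_coeff (k - 1)) p v + R_coeff (k - 1) p ** commutator (G p) (mat_d (\<lambda>x. diag_mat (u x)) p v)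
          = commutator (R_coeff k p) (mat_d (\<lambda>x. diag_mat (u x)) p v)"
    using frame_equation_iff[OF _ p] R_coeff_properties[of "k - 1"] by blast
qed (use R_coeff_properties in \<open>auto simp: euler_def\<close>)

end

section \<open>The homogeneous fundamental matrix of a flat F-manifold\<close>

context rotation_matrix
begin

text \<open>
  The rotation coefficient \<open>(i,j)\<close> is the entry \<open>(i,j)\<close> of \<open>conn j\<close>, so it inherits the degree given by
  \<open>homogeneous_connection\<close>.
\<close>

lemma homogeneous_rotation_matrixI:
  assumes P: "holmat P" "\<And>x. x \<in> V \<Longrightarrow> invertible (P x)"
    and eq: "\<And>a x. x \<in> V \<Longrightarrow> mat_partial a P x = conn a x ** P x"
    and hom: "\<And>x. x \<in> V \<Longrightarrow> mat_euler P x = diag_mat \<delta> ** P x + P x ** Q"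
  shows "homogeneous_rotation_matrix V u G \<delta>"
proof unfold_locales
  fix p a b assume p: "p \<in> V"
  show "mat_partial b (conn a) p + conn a p ** conn b p = mat_partial a (conn b) p + conn b p ** conn a p"
    by (rule flat_connection[OF holmat_conn P eq p])
next
  fix p i j assume p: "p \<in> V"
  show "euler (\<lambda>x. G x $ i $ j) p = (\<delta> $ i - \<delta> $ j - 1) * G p $ i $ j"
  proof (cases "i = j")
    case True
    then have "euler (\<lambda>x. G x $ i $ j) p = euler (\<lambda>_. 0) p"
      by (intro euler_cong[OF p]) (simp add: G_diag)
    then show ?thesis using True p by (simp add: euler_const G_diag)
  next
    case False
    have "mat_euler (conn j) p $ i $ j = (commutator (diag_mat \<delta>) (conn j p) - conn j p) $ i $ j"
      using homogeneous_connection[OF holmat_conn P eq hom p, of j] by simp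
    then show ?thesis
      using False by (simp add: mat_euler_def conn_nth commutator_def diag_mult_nth mult_diag_nth axis_def algebra_simps)
  qed
qed

end

context holomorphic_chart
begin

text \<open>
  The inverse is the Jacobian matrix of \<open>t\<close> with respect to \<open>u\<close>.
\<close>

lemma Psi_tilde_invertible:
  assumes t: "coordinates_on t V" and p: "p \<in> V"
  shows "invertible (Psi_tilde t u p)"
proof -
  interpret T: holomorphic_chart V t using t open_domain by unfold_locales
  have "Psi_tilde t u p ** (\<chi> \<alpha> k. coord_partial u k (\<lambda>x. t x $ \<alpha>) p) = mat 1"
  proof -
    have "(\<Sum>\<alpha>\<in>UNIV. coord_partial t \<alpha> (\<lambda>x. u x $ i) p * coord_partial u k (\<lambda>x. t x $ \<alpha>) p)
        = coord_partial u k (\<lambda>x. u x $ i) p" for i k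
      using T.differential_expansion[OF coordinate_hol p, of i "coord_vf u k p"]
      by (simp add: coord_partial_def[of u] mult.commute)
    then show ?thesis
      by (simp add: vec_eq_iff matrix_mult_nth Psi_tilde_def partial_coordinate[OF p] mat_def)
  qed
  then show ?thesis by (auto simp: invertible_right_inverse)
qed

lemma Psi_tilde_hol:
  assumes "coordinates_on t V"
  shows "holmat (Psi_tilde t u)"
proof -
  interpret T: holomorphic_chart V t using assms open_domain by unfold_locales
  show ?thesis
    by (simp add: holomorphic_mat_on_def Psi_tilde_def T.partial_hol(1) coordinate_hol)
qed

lemma euler_eq_derivative:
  assumes "hol f" "p \<in> V" "v = (\<Sum>i\<in>UNIV. u p $ i *s coord_vf u i p)"
  shows "frechet_derivative f (at p) v = euler f p"
  by (simp add: assms euler_def holomorphic_fun_on_sum_vector[OF assms(1,2)] coord_partial_def)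

text \<open>
  Differentiate \<open>E u\<^sup>i = u\<^sup>i\<close> with respect to \<open>t\<^sup>\<beta>\<close>.  Since \<open>E\<close> is affine with diagonal linear part in the
  coordinates \<open>t\<close>, one has \<open>[\<partial>/\<partial>t\<^sup>\<beta>, E] = (1 - q\<^sub>\<beta>) \<partial>/\<partial>t\<^sup>\<beta>\<close>.
\<close>

lemma euler_Psi_tilde:
  assumes t: "coordinates_on t V"
    and E: "\<And>p. p \<in> V \<Longrightarrow> E p = (\<Sum>i\<in>UNIV. u p $ i *s coord_vf u i p)"
      "\<And>p. p \<in> V \<Longrightarrow> E p = (\<Sum>\<alpha>\<in>UNIV. ((1 - q $ \<alpha>) * t p $ \<alpha> + r $ \<alpha>) *s coord_vf t \<alpha> p)"
    and p: "p \<in> V"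
  shows "euler (\<lambda>x. Psi_tilde t u x $ i $ \<beta>) p = q $ \<beta> * Psi_tilde t u p $ i $ \<beta>"
proof -
  interpret T: holomorphic_chart V t using t open_domain by unfold_locales
  define c where "c \<alpha> x = (1 - q $ \<alpha>) * t x $ \<alpha> + r $ \<alpha>" for \<alpha> x
  let ?u = "\<lambda>x. u x $ i"
  have eul: "euler f x = (\<Sum>\<alpha>\<in>UNIV. c \<alpha> x * coord_partial t \<alpha> f x)" if "hol f" "x \<in> V" for f x
    using euler_eq_derivative[OF that E(1)[OF that(2)]]
    unfolding E(2)[OF that(2)] holomorphic_fun_on_sum_vector[OF that]
    by (simp add: c_def coord_partial_def)
  have hc: "hol (c \<alpha>)" for \<alpha>
    unfolding c_def[abs_def]
    by (intro holomorphic_fun_on_add holomorphic_fun_on_mult holomorphic_fun_on_const T.coordinate_hol open_domain)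
  have dc: "coord_partial t \<beta> (c \<alpha>) p = (if \<alpha> = \<beta> then 1 - q $ \<beta> else 0)" for \<alpha>
  proof -
    have "hol (\<lambda>x. (1 - q $ \<alpha>) * t x $ \<alpha>)"
      by (intro holomorphic_fun_on_mult holomorphic_fun_on_const T.coordinate_hol open_domain)
    then show ?thesis
      unfolding c_def[abs_def] using p
      by (simp add: T.partial_add T.partial_cmult holomorphic_fun_on_const open_domain T.coordinate_hol T.partial_coordinate)
  qed
  have u: "?u x = (\<Sum>\<alpha>\<in>UNIV. c \<alpha> x * coord_partial t \<alpha> ?u x)" if "x \<in> V" for x
  proof -
    have "euler ?u x = ?u x"
      using that by (simp add: euler_def partial_coordinate if_distrib[of "\<lambda>x. _ * x"] cong: if_cong)
    then show ?thesis using eul[OF coordinate_hol that] by simp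
  qed
  have "coord_partial t \<beta> ?u p = coord_partial t \<beta> (\<lambda>x. \<Sum>\<alpha>\<in>UNIV. c \<alpha> x * coord_partial t \<alpha> ?u x) p"
    by (rule T.partial_cong[OF p u])
  also have "\<dots> = (\<Sum>\<alpha>\<in>UNIV. (if \<alpha> = \<beta> then 1 - q $ \<beta> else 0) * coord_partial t \<alpha> ?u p
       + c \<alpha> p * coord_partial t \<beta> (coord_partial t \<alpha> ?u) p)"
    using p by (simp add: T.partial_sum T.partial_mult hc T.partial_hol(1) coordinate_hol holomorphic_fun_on_mult dc)
  also have "\<dots> = (1 - q $ \<beta>) * coord_partial t \<beta> ?u p + euler (coord_partial t \<beta> ?u) p"
    unfolding eul[OF T.partial_hol(1)[OF coordinate_hol] p] T.partial_hol(2)[OF coordinate_hol p, of \<beta>]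
    by (simp add: sum.distrib if_distrib[of "\<lambda>x. x * _"] cong: if_cong)
  finally show ?thesis by (simp add: Psi_tilde_def algebra_simps)
qed

end

theorem proposition1p16:
  fixes M V :: "(complex^'n::finite) set"
    and Chr mlt :: "'n tensor21"
    and e E :: "'n vfield"
    and p\<^sub>0 :: "complex^'n"
    and t u h :: "complex^'n \<Rightarrow> complex^'n"
    and Dt :: "complex^'n \<Rightarrow> complex^'n \<Rightarrow> complex^'n^'n"
    and Gt G :: "complex^'n \<Rightarrow> complex^'n^'n"
    and \<delta> :: "complex^'n"
  assumes F_mfd: "flat_F_manifold M Chr mlt e"
    and semisimple: "p\<^sub>0 \<in> M" "semisimple_point mlt p\<^sub>0"
    and nbhd: "open V" "p\<^sub>0 \<in> V" "V \<subseteq> M" "connected V" "simply_connected V"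
    and flat_coords: "flat_coordinates Chr V t"
    and euler: "euler_vector_field M mlt e V t E"
    and canonical_coords: "canonical_coordinates mlt V u"
    and euler_canonical: "\<forall>p\<in>V. E p = (\<Sum>i\<in>UNIV. u p $ i *s coord_vf u i p)"
    and decomposition: "Psi_tilde_decomposition V t u Dt Gt"
    and H_holomorphic: "holomorphic_vec_on h V"
    and H_nondegenerate: "\<forall>p\<in>V. \<forall>i. h p $ i \<noteq> 0"
    and H_equation: "\<forall>p\<in>V. \<forall>v. mat_d (\<lambda>x. diag_mat (h x)) p v ** matrix_inv (diag_mat (h p)) = - Dt p v"
    and rotation_coefficients: "\<forall>p\<in>V. G p = diag_mat (h p) ** Gt p ** matrix_inv (diag_mat (h p))"
    and delta: "\<forall>p\<in>V. Dt p (E p) = - diag_mat \<delta>"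
  shows "\<exists>R. homogeneous_R_matrices V u G \<delta> R \<and>
           (\<forall>W R'. open W \<longrightarrow> connected W \<longrightarrow> p\<^sub>0 \<in> W \<longrightarrow> W \<subseteq> V \<longrightarrow>
              homogeneous_R_matrices W u G \<delta> R' \<longrightarrow> (\<forall>k. \<forall>p\<in>W. R' k p = R k p))"
proof -
  have t: "coordinates_on t V" and u: "coordinates_on u V"
    using flat_coords canonical_coords by (auto simp: flat_coordinates_def canonical_coordinates_def)
  interpret U: holomorphic_chart V u using nbhd(1) u by unfold_locales
  have h: "U.hol (\<lambda>x. h x $ i)" for i
    using H_holomorphic by (simp add: holomorphic_vec_on_def)
  have Gt: "U.holmat Gt" "\<And>p i. p \<in> V \<Longrightarrow> Gt p $ i $ i = 0"
    using decomposition by (auto simp: Psi_tilde_decomposition_def)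
  have G_nth: "G p $ i $ j = h p $ i * Gt p $ i $ j * inverse (h p $ j)" if "p \<in> V" for p i j
    using that rotation_coefficients H_nondegenerate
    by (simp add: matrix_inv_diag_mat(1) mult_diag_nth diag_mult_nth)
  have G: "rotation_matrix V u G"
  proof unfold_locales
    have "U.hol (\<lambda>x. h x $ i * Gt x $ i $ j * inverse (h x $ j))" for i j
      by (intro holomorphic_fun_on_mult holomorphic_fun_on_inverse h U.holmat_nth Gt(1))
        (use H_nondegenerate in auto)
    then show "U.holmat G"
      by (simp add: holomorphic_mat_on_def G_nth cong: holomorphic_fun_on_cong)
  qed (simp add: G_nth Gt)
  interpret Rot: rotation_matrix V u G by (rule G)
  let ?H = "\<lambda>x. diag_mat (h x)" and ?Pt = "Psi_tilde t u"
  \<comment> \<open>The gauge factor \<open>H\<close> removes the diagonal part \<open>D\<close> of the connection of \<open>\<Psi>~\<close>.\<close>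
  define P where "P x = ?H x ** ?Pt x" for x
  have H: "U.holmat ?H" by (rule U.holmat_diag[OF h])
  have Hinv: "invertible (?H x)" "matrix_inv (?H x) ** ?H x = mat 1" if "x \<in> V" for x
    using matrix_inv_diag_mat(2,3)[of "h x"] H_nondegenerate that by auto
  have Pt: "U.holmat ?Pt" "\<And>x. x \<in> V \<Longrightarrow> invertible (?Pt x)"
    using U.Psi_tilde_hol[OF t] U.Psi_tilde_invertible[OF t] by auto
  have dH: "mat_d ?H x v = - (Dt x v ** ?H x)" if "x \<in> V" for x v
    using eq_mult_of_mult_matrix_inv[OF Hinv(1)[OF that]] H_equation that
    by (metis matrix_minus_mult)
  have dPt: "mat_d ?Pt x v = (Dt x v + commutator (Gt x) (mat_d (\<lambda>x. diag_mat (u x)) x v)) ** ?Pt x"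
    if "x \<in> V" for x v
    by (rule eq_mult_of_mult_matrix_inv[OF Pt(2)[OF that]])
      (use decomposition that in \<open>simp add: Psi_tilde_decomposition_def\<close>)
  have HDt: "?H x ** Dt x v = Dt x v ** ?H x" if "x \<in> V" for x v
  proof -
    have "Dt x v = diag_mat (\<chi> i. Dt x v $ i $ i)"
      using decomposition that by (auto simp: Psi_tilde_decomposition_def vec_eq_iff diag_mat_def)
    then show ?thesis by (metis diag_mat_commute)
  qed
  have "homogeneous_rotation_matrix V u G \<delta>"
  proof -
    obtain q r where E: "\<And>p. p \<in> V \<Longrightarrow> E p = (\<Sum>\<alpha>\<in>UNIV. ((1 - q $ \<alpha>) * t p $ \<alpha> + r $ \<alpha>) *s coord_vf t \<alpha> p)"
      using euler by (auto simp: euler_vector_field_def)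
    show ?thesis
    proof (rule Rot.homogeneous_rotation_matrixI[where P=P and Q="diag_mat q"])
      show "U.holmat P"
        unfolding P_def[abs_def] by (intro U.holmat_mult H Pt)
      show "invertible (P x)" if "x \<in> V" for x
        unfolding P_def using Hinv(1)[OF that] Pt(2)[OF that] by (rule invertible_mult)
      show "U.mat_partial a P x = Rot.conn a x ** P x" if x: "x \<in> V" for a x
      proof -
        \<comment> \<open>Pushing \<open>H\<close> through the commutator replaces
            \<open>\<Gamma>~\<close> by \<open>\<Gamma>\<close>; the \<open>D\<close>-terms of \<open>dH\<close> and \<open>d\<Psi>~\<close> cancel.\<close>
        have GH: "G x ** ?H x = ?H x ** Gt x"
          using rotation_coefficients x Hinv(2)[OF x] by (metis matrix_mul_assoc matrix_mul_rid)
        then have GH': "Z ** G x ** ?H x = Z ** ?H x ** Gt x" for Z :: "complex^'n^'n"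
          by (metis matrix_mul_assoc)
        have EH: "Z ** coord_proj a ** ?H x = Z ** ?H x ** coord_proj a" for Z :: "complex^'n^'n"
          by (metis diag_mat_commute matrix_mul_assoc)
        have "U.mat_partial a P x = U.mat_partial a ?H x ** ?Pt x + ?H x ** U.mat_partial a ?Pt x"
          unfolding P_def[abs_def] by (rule U.mat_partial_mult[OF H Pt(1) x])
        also have "\<dots> = mat_d ?H x (coord_vf u a x) ** ?Pt x + ?H x ** mat_d ?Pt x (coord_vf u a x)"
          by (simp add: U.mat_d_coord_vf H Pt(1) x)
        also have "\<dots> = ?H x ** commutator (Gt x) (coord_proj a) ** ?Pt x"
          unfolding dH[OF x] dPt[OF x]
          by (simp add: matrix_ring_simps HDt[OF x] matrix_minus_mult U.mat_d_diag_coordinates U.differential_coord_vf x)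
        also have "\<dots> = Rot.conn a x ** P x"
          by (simp add: Rot.conn_def P_def commutator_def matrix_ring_simps EH GH GH' diag_mat_commute[of "axis a 1" "h x"])
        finally show ?thesis .
      qed
      show "U.mat_euler P x = diag_mat \<delta> ** P x + P x ** diag_mat q" if x: "x \<in> V" for x
      proof -
        have "U.euler (\<lambda>x. h x $ i) x = \<delta> $ i * h x $ i" for i
        proof -
          have "mat_d ?H x (E x) $ i $ i = (diag_mat \<delta> ** ?H x) $ i $ i"
            using dH[OF x, of "E x"] delta x by (simp add: matrix_minus_mult)
          then have "frechet_derivative (\<lambda>x. h x $ i) (at x) (E x) = \<delta> $ i * h x $ i"
            using U.mat_d_diag_nth[of h x "E x", OF h x] by (simp add: diag_mult_nth) (simp add: diag_mat_def)
          then show ?thesis using U.euler_eq_derivative[OF h x] euler_canonical x by simp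
        qed
        moreover have "U.euler (\<lambda>x. ?Pt x $ i $ j) x = q $ j * ?Pt x $ i $ j" for i j
          using U.euler_Psi_tilde[OF t _ E x] euler_canonical by simp
        ultimately have "U.euler (\<lambda>x. h x $ i * ?Pt x $ i $ j) x = (\<delta> $ i + q $ j) * (h x $ i * ?Pt x $ i $ j)" for i j
          using x by (simp add: U.euler_mult h U.holmat_nth Pt(1) algebra_simps)
        then show ?thesis
          by (simp add: vec_eq_iff U.mat_euler_def P_def diag_mult_nth mult_diag_nth algebra_simps)
      qed
    qed
  qed
  then interpret Hom: homogeneous_rotation_matrix V u G \<delta> .
  have "R' k p = Hom.R_coeff k p"
    if W: "open W" "W \<subseteq> V" and R': "homogeneous_R_matrices W u G \<delta> R'" and "p \<in> W" for W R' k p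
    using \<open>p \<in> W\<close>
  proof (induction k arbitrary: p)
    case 0
    then show ?case using R' by (simp add: homogeneous_R_matrices_def)
  next
    case (Suc k)
    interpret W: rotation_matrix W u G
    proof unfold_locales
      show "coordinates_on u W"
        using u W by (auto simp: coordinates_on_def holomorphic_vec_on_def
            intro: holomorphic_fun_on_subset inj_on_subset)
      show "holomorphic_mat_on G W"
        using Rot.G_hol W by (auto simp: holomorphic_mat_on_def intro: holomorphic_fun_on_subset)
    qed (use W Rot.G_diag in auto)
    have "R' (Suc k) p = Rot.next_coeff k (R' k) p"
      by (rule W.R_matrices_recursion[OF R' Suc.prems])
    also have "\<dots> = Rot.next_coeff k (Hom.R_coeff k) p"
    proof -
      have "coord_partial u j (\<lambda>x. R' k x $ i $ l) p = coord_partial u j (\<lambda>x. Hom.R_coeff k x $ i $ l) p" for i j l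
        by (rule W.partial_cong[OF Suc.prems]) (simp add: Suc.IH)
      then show ?thesis by (simp add: Rot.next_coeff_def Suc.IH[OF Suc.prems])
    qed
    finally show ?case by simp
  qed
  then show ?thesis using Hom.homogeneous_R_matrices_R_coeff by blast
qed

end
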